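(* Let $s\ge 6$ be even and $N\ge 2s$. Then for all $t\in[-\pi,\pi]\setminus\{0\}$ and $l=0,1,2,3$, $$|\tilde\sigma_N^{(l)}(t)|\le\frac{c_{l,s}}{(N+1)^{s-l}|t|^s},$$ where $c_{0,s}=1.02\,(s-1)!\,2^s s$, $c_{1,s}=1.02\,(s-1)!\,2^s\cdot 2s$, $c_{2,s}=1.02\,(s-1)!\,2^s(4s+1)$, $c_{3,s}=1.02\,(s-1)!\,2^s(9s-2)$.
   Context: For even $s\ge 6$, the perfect B-spline is $g_{s-1}(x)=\frac{(-1)^{s-1}}{(s-2)!}\int_{-1}^{x}\sum_{k=0}^{s-1}(-1)^k\chi_{(\cos(\frac{(k+1)\pi}{s}),\cos(\frac{k\pi}{s})]}(t)(x-t)^{s-2}\,dt$ for $x\in[-1,1]$ and $0$ otherwise; $\tilde g_{s-1}(x)=g_{s-1}(2x)$. For $N\in\mathbb N$, $\|\tilde g_{s-1}\|_{1,N}=\sum_{k=-N}^N\tilde g_{s-1}(\frac{k}{2(N+1)})$ and $\tilde\sigma_N(t)=\|\tilde g_{s-1}\|_{1,N}^{-1}\sum_{k=-N}^{N}\tilde g_{s-1}(\frac{k}{2(N+1)})e^{ikt}$, a trigonometric polynomial; $\tilde\sigma_N^{(l)}$ is its $l$-th derivative. *)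

theory Defs
  imports "HOL-Analysis.Analysis"
begin

definition perfect_bspline :: "nat \<Rightarrow> real \<Rightarrow> real" where
  "perfect_bspline s x =
     (if x \<in> {-1..1} then
        (-1) ^ (s - 1) / fact (s - 2) *
        integral {-1..x} (\<lambda>t. (\<Sum>k = 0..s - 1. (-1) ^ k *
            indicator {cos (real (k + 1) * pi / real s) <.. cos (real k * pi / real s)} t)
            * (x - t) ^ (s - 2))
      else 0)"

definition gtilde :: "nat \<Rightarrow> real \<Rightarrow> real" where
  "gtilde s x = perfect_bspline s (2 * x)"

definition gnorm1 :: "nat \<Rightarrow> nat \<Rightarrow> real" where
  "gnorm1 s N = (\<Sum>k = -int N..int N. gtilde s (real_of_int k / (2 * (real N + 1))))"

definition sigma_tilde :: "nat \<Rightarrow> nat \<Rightarrow> real \<Rightarrow> complex" where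
  "sigma_tilde s N t = complex_of_real (inverse (gnorm1 s N)) *
     (\<Sum>k = -int N..int N. complex_of_real (gtilde s (real_of_int k / (2 * (real N + 1))))
        * exp (\<i> * of_int k * complex_of_real t))"

definition nth_vderiv :: "nat \<Rightarrow> (real \<Rightarrow> complex) \<Rightarrow> real \<Rightarrow> complex" where
  "nth_vderiv l f = ((\<lambda>g t. vector_derivative g (at t)) ^^ l) f"

definition cconst :: "nat \<Rightarrow> nat \<Rightarrow> real" where
  "cconst l s = 1.02 * fact (s - 1) * 2 ^ s *
     (if l = 0 then real s else if l = 1 then 2 * real s
      else if l = 2 then 4 * real s + 1 else 9 * real s - 2)"

end

theory Submission
  imports Defs "HOL-Real_Asymp.Real_Asymp"
begin

text \<open>
For even \<open>s\<close> the perfect B-spline is the combination of truncated powers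
\<open>spl s s x = (\<Sum>k\<le>s. wt s k * (x - knot s k)\<^sub>+ ^ (s - 1) / (s - 1)!)\<close> with knots
\<open>- cos (k pi / s)\<close> and weights \<open>1, -2, 2, ..., -2, 1\<close>, which annihilate all polynomials of
degree below \<open>s\<close>. The derivative of order \<open>s - 1\<close> of \<open>x ^ l * spl s s x\<close> has total variation at
most \<open>2 * deriv_coeff l s\<close>, because the derivatives of the spline of orders \<open>s - 1\<close>,
\<open>s - 2\<close>, \<open>s - 3\<close> are bounded by \<open>1\<close>, \<open>2 / s\<close>, \<open>4 / s\<^sup>2\<close>. Summation by parts of order \<open>s\<close>
turns this into a bound for exponential sums over a grid of mesh \<open>h\<close>, of size
\<open>h ^ (s - 1) / (2 \<bar>sin (t / 2)\<bar>) ^ s\<close>.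

For \<open>t\<close> near \<open>pi\<close> this is too weak by a factor exponential in \<open>s\<close>. So the grid is first refined by
a factor \<open>R\<close>: the original sum is the average of the sums over the finer grid at the \<open>R\<close> aliased
frequencies \<open>(t + 2 pi r) / R\<close>, and for \<open>R \<rightarrow> \<infinity>\<close> the bounds add up to
\<open>(\<Sum>r. 1 / \<bar>t + 2 pi r\<bar> ^ s) \<le> 2.02 / \<bar>t\<bar> ^ s\<close>. The same identity for \<open>t = 0\<close> compares the
normalising sum with the integral of the spline, which is \<open>2 ^ (2 - s) / (s - 1)!\<close>.
\<close>

subsection \<open>Finite differences\<close>

text \<open>Suited to piecewise polynomials: continuity lets the derivative control increments
  across the exceptional points, and the values of \<open>f'\<close> at those points are
  immaterial.\<close>

definition weak_deriv :: "(real \<Rightarrow> real) \<Rightarrow> (real \<Rightarrow> real) \<Rightarrow> bool" where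
  "weak_deriv f f' \<longleftrightarrow> continuous_on UNIV f \<and>
     (\<exists>S. finite S \<and> (\<forall>x. x \<notin> S \<longrightarrow> (f has_real_derivative f' x) (at x)))"

text \<open>For a continuous function the fundamental theorem of calculus tolerates a finite
  exceptional set. Resetting the derivative to 0 there makes the integrand nonnegative
  everywhere.\<close>

lemma nondecreasing_off_finite:
  fixes f f' :: "real \<Rightarrow> real"
  assumes ab: "a \<le> b" and cont: "continuous_on {a..b} f" and S: "finite S"
    and deriv: "\<And>x. x \<in> {a<..<b} - S \<Longrightarrow> (f has_real_derivative f' x) (at x)"
    and nonneg: "\<And>x. x \<in> {a<..<b} - S \<Longrightarrow> 0 \<le> f' x"
  shows "f a \<le> f b"
proof -
  define g where "g x = (if x \<in> {a<..<b} - S then f' x else 0)" for x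
  have "(g has_integral (f b - f a)) {a..b}"
  proof (rule fundamental_theorem_of_calculus_interior_strong[OF S ab _ cont])
    fix x assume "x \<in> {a<..<b} - S"
    then show "(f has_vector_derivative g x) (at x)"
      using deriv[of x] by (simp add: g_def has_real_derivative_iff_has_vector_derivative)
  qed
  moreover have "0 \<le> g x" for x using nonneg by (simp add: g_def)
  ultimately have "0 \<le> f b - f a" by (rule has_integral_nonneg)
  then show ?thesis by simp
qed

text \<open>One-sided mean value estimate: \<open>B * x - f x\<close> is nondecreasing.\<close>

lemma weak_deriv_increment_le:
  assumes f: "weak_deriv f f'" and B: "\<And>x. a < x \<Longrightarrow> x < b \<Longrightarrow> f' x \<le> B" and "a \<le> b"
  shows "f b - f a \<le> B * (b - a)"
proof -
  obtain S where S: "finite S" "\<And>x. x \<notin> S \<Longrightarrow> (f has_real_derivative f' x) (at x)"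
    and cont: "continuous_on UNIV f"
    using f unfolding weak_deriv_def by blast
  have "(\<lambda>x. B * x - f x) a \<le> (\<lambda>x. B * x - f x) b"
  proof (rule nondecreasing_off_finite[OF \<open>a \<le> b\<close> _ S(1), of _ "\<lambda>x. B - f' x"])
    show "continuous_on {a..b} (\<lambda>x. B * x - f x)"
      by (intro continuous_intros continuous_on_subset[OF cont]) auto
    fix x assume "x \<in> {a<..<b} - S"
    then have "(f has_real_derivative f' x) (at x)" using S by blast
    then show "((\<lambda>x. B * x - f x) has_real_derivative B - f' x) (at x)"
      by (auto intro!: derivative_eq_intros)
  qed (use B in auto)
  then show ?thesis by (simp add: algebra_simps)
qed

lemma weak_deriv_const: "weak_deriv (\<lambda>x. c) (\<lambda>x. 0)"
  unfolding weak_deriv_def by (auto intro!: exI[of _ "{}"] continuous_intros)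

lemma weak_deriv_id: "weak_deriv (\<lambda>x. x) (\<lambda>x. 1)"
  unfolding weak_deriv_def by (auto intro!: exI[of _ "{}"] continuous_intros)

lemma weak_deriv_add:
  assumes "weak_deriv f f'" "weak_deriv g g'"
  shows "weak_deriv (\<lambda>x. f x + g x) (\<lambda>x. f' x + g' x)"
proof -
  obtain S T where "finite S" "\<forall>x. x \<notin> S \<longrightarrow> (f has_real_derivative f' x) (at x)"
    "finite T" "\<forall>x. x \<notin> T \<longrightarrow> (g has_real_derivative g' x) (at x)"
    using assms unfolding weak_deriv_def by metis
  then show ?thesis
    using assms unfolding weak_deriv_def
    by (auto intro!: continuous_intros exI[of _ "S \<union> T"] derivative_intros)
qed

lemma weak_deriv_mult:
  assumes "weak_deriv f f'" "weak_deriv g g'"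
  shows "weak_deriv (\<lambda>x. f x * g x) (\<lambda>x. f' x * g x + g' x * f x)"
proof -
  obtain S T where "finite S" "\<forall>x. x \<notin> S \<longrightarrow> (f has_real_derivative f' x) (at x)"
    "finite T" "\<forall>x. x \<notin> T \<longrightarrow> (g has_real_derivative g' x) (at x)"
    using assms unfolding weak_deriv_def by metis
  then show ?thesis
    using assms unfolding weak_deriv_def
    by (auto intro!: continuous_intros exI[of _ "S \<union> T"] DERIV_mult)
qed

lemma weak_deriv_cmult:
  assumes "weak_deriv f f'"
  shows "weak_deriv (\<lambda>x. c * f x) (\<lambda>x. c * f' x)"
  using weak_deriv_mult[OF weak_deriv_const[of c] assms] by (simp add: mult.commute)

lemma weak_deriv_sum:
  assumes "\<And>i. i \<in> I \<Longrightarrow> weak_deriv (f i) (f' i)"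
  shows "weak_deriv (\<lambda>x. \<Sum>i\<in>I. f i x) (\<lambda>x. \<Sum>i\<in>I. f' i x)"
  using assms
  by (induction I rule: infinite_finite_induct) (auto intro: weak_deriv_const weak_deriv_add)

lemma weak_deriv_shift:
  assumes "weak_deriv f f'"
  shows "weak_deriv (\<lambda>x. f (x + d)) (\<lambda>x. f' (x + d))"
proof -
  obtain S where S: "finite S" "\<forall>x. x \<notin> S \<longrightarrow> (f has_real_derivative f' x) (at x)"
    and cont: "continuous_on UNIV f"
    using assms unfolding weak_deriv_def by metis
  have "continuous_on UNIV (\<lambda>x. f (x + d))"
    by (rule continuous_on_compose2[OF cont]) (auto intro!: continuous_intros)
  moreover have "((\<lambda>x. f (x + d)) has_real_derivative f' (x + d)) (at x)"
    if "x \<notin> (\<lambda>z. z - d) ` S" for x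
  proof -
    have "x + d \<notin> S" using that by (metis add_diff_cancel_right' imageI)
    then have "(f has_real_derivative f' (x + d)) (at (x + d))" using S(2) by blast
    then show ?thesis by (simp add: DERIV_shift)
  qed
  ultimately show ?thesis
    unfolding weak_deriv_def using S(1)
    by (intro conjI exI[of _ "(\<lambda>z. z - d) ` S"]) auto
qed

definition fwd_diff :: "real \<Rightarrow> (real \<Rightarrow> real) \<Rightarrow> real \<Rightarrow> real" where
  "fwd_diff h f x = f (x + h) - f x"

lemma weak_deriv_fwd_diff:
  assumes "weak_deriv f f'"
  shows "weak_deriv (fwd_diff h f) (fwd_diff h f')"
proof -
  have "weak_deriv (\<lambda>x. f (x + h) + (-1) * f x) (\<lambda>x. f' (x + h) + (-1) * f' x)"
    by (intro weak_deriv_add weak_deriv_cmult weak_deriv_shift assms)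
  then show ?thesis by (simp add: fwd_diff_def[abs_def])
qed

lemma weak_deriv_fwd_diff_iter:
  assumes "weak_deriv f f'"
  shows "weak_deriv ((fwd_diff h ^^ m) f) ((fwd_diff h ^^ m) f')"
  by (induction m) (auto intro: assms weak_deriv_fwd_diff)

text \<open>With the signs of the differences frozen, the sum of absolute values becomes an increment of a
  single function, to which the mean value estimate applies.\<close>

lemma sum_abs_fwd_diff_Suc_le:
  assumes f: "weak_deriv f f'" and h: "h \<ge> 0" and I: "finite (I :: int set)"
    and V: "\<And>x. (\<Sum>n\<in>I. \<bar>(fwd_diff h ^^ m) f' (x + of_int n * h)\<bar>) \<le> V"
  shows "(\<Sum>n\<in>I. \<bar>(fwd_diff h ^^ Suc m) f (x + of_int n * h)\<bar>) \<le> h * V"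
proof -
  define e where "e n = sgn ((fwd_diff h ^^ Suc m) f (x + of_int n * h))" for n :: int
  define \<Phi> where "\<Phi> y = (\<Sum>n\<in>I. e n * (fwd_diff h ^^ m) f (y + of_int n * h))" for y
  define \<Phi>' where "\<Phi>' y = (\<Sum>n\<in>I. e n * (fwd_diff h ^^ m) f' (y + of_int n * h))" for y
  have wd: "weak_deriv \<Phi> \<Phi>'"
    unfolding \<Phi>_def[abs_def] \<Phi>'_def[abs_def]
    by (intro weak_deriv_sum weak_deriv_cmult weak_deriv_shift weak_deriv_fwd_diff_iter f)
  have bd: "\<Phi>' y \<le> V" for y
  proof -
    have "\<Phi>' y \<le> (\<Sum>n\<in>I. \<bar>(fwd_diff h ^^ m) f' (y + of_int n * h)\<bar>)"
      unfolding \<Phi>'_def e_def by (intro sum_mono) (auto simp: sgn_if)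
    then show ?thesis using V[of y] by linarith
  qed
  have "(\<Sum>n\<in>I. \<bar>(fwd_diff h ^^ Suc m) f (x + of_int n * h)\<bar>) = \<Phi> (x + h) - \<Phi> x"
    unfolding \<Phi>_def sum_subtractf[symmetric]
  proof (rule sum.cong[OF refl])
    fix n assume "n \<in> I"
    have "\<bar>(fwd_diff h ^^ Suc m) f (x + of_int n * h)\<bar> = e n * (fwd_diff h ^^ Suc m) f (x + of_int n * h)"
      by (simp add: e_def sgn_if)
    also have "\<dots> = e n * (fwd_diff h ^^ m) f (x + h + of_int n * h) - e n * (fwd_diff h ^^ m) f (x + of_int n * h)"
      by (simp add: fwd_diff_def algebra_simps)
    finally show "\<bar>(fwd_diff h ^^ Suc m) f (x + of_int n * h)\<bar> =
      e n * (fwd_diff h ^^ m) f (x + h + of_int n * h) - e n * (fwd_diff h ^^ m) f (x + of_int n * h)" .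
  qed
  also have "\<dots> \<le> V * (x + h - x)"
    by (rule weak_deriv_increment_le[OF wd bd]) (use h in simp)
  finally show ?thesis by (simp add: mult.commute)
qed

text \<open>Each step to the antiderivative \<open>f (Suc m)\<close> comes with one more difference
  and costs one factor \<open>h\<close>. The chain starts at order 1, where \<open>f 1\<close> may
  jump and \<open>V\<close> bounds its variation on the grid.\<close>

lemma sum_abs_fwd_diff_chain_le:
  assumes chain: "\<And>m. 1 \<le> m \<Longrightarrow> m < M \<Longrightarrow> weak_deriv (f (Suc m)) (f m)"
    and h: "h \<ge> 0" and I: "finite (I :: int set)"
    and V: "\<And>x. (\<Sum>n\<in>I. \<bar>fwd_diff h (f 1) (x + of_int n * h)\<bar>) \<le> V"
    and m: "1 \<le> m" "m \<le> M"
  shows "(\<Sum>n\<in>I. \<bar>(fwd_diff h ^^ m) (f m) (x + of_int n * h)\<bar>) \<le> h ^ (m - 1) * V"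
  using m
proof (induction m arbitrary: x)
  case (Suc m)
  show ?case
  proof (cases "m = 0")
    case True
    then show ?thesis using V by simp
  next
    case False
    then obtain j where j: "m = Suc j" using not0_implies_Suc by blast
    have "(\<Sum>n\<in>I. \<bar>(fwd_diff h ^^ Suc m) (f (Suc m)) (x + of_int n * h)\<bar>) \<le> h * (h ^ (m - 1) * V)"
      by (rule sum_abs_fwd_diff_Suc_le[OF chain h I]) (use Suc False in auto)
    then show ?thesis by (simp add: j)
  qed
qed simp

text \<open>Summation by parts: shifting the index multiplies the exponential by
  \<open>cis (-\<tau>)\<close>. Each forward difference spreads the support by one grid point to the
  left, which is why \<open>f\<close> leaves a margin of \<open>m\<close> points at the left end of
  the window.\<close>

lemma sum_fwd_diff_exp:
  fixes f :: "real \<Rightarrow> real" and L :: int and \<tau> h :: real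
  assumes "\<And>n :: int. n \<notin> {-L + int m..L} \<Longrightarrow> f (of_int n * h) = 0"
  shows "(\<Sum>n = -L..L. of_real ((fwd_diff h ^^ m) f (of_int n * h)) * cis (of_int n * \<tau>)) =
    (cis (-\<tau>) - 1) ^ m * (\<Sum>n = -L..L. of_real (f (of_int n * h)) * cis (of_int n * \<tau>))"
  using assms
proof (induction m arbitrary: f)
  case (Suc m)
  have shift: "fwd_diff h f (of_int n * h) = f (of_int (n + 1) * h) - f (of_int n * h)" for n
    by (simp add: fwd_diff_def algebra_simps)
  have z: "fwd_diff h f (of_int n * h) = 0" if "n \<notin> {-L + int m..L}" for n :: int
    unfolding shift using that Suc.prems[of n] Suc.prems[of "n + 1"] by auto
  \<comment> \<open>The shift brings in the index \<open>L + 1\<close> and drops \<open>-L\<close>;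
    \<open>f\<close> vanishes at both, so the window can be kept.\<close>
  have 1: "(\<Sum>n = -L..L. of_real (f (of_int (n + 1) * h)) * cis (of_int n * \<tau>)) =
      (\<Sum>n = -L..L. of_real (f (of_int n * h)) * cis (of_int (n - 1) * \<tau>))"
  proof (cases "L < 0")
    case False
    have "(\<Sum>n = -L..L. of_real (f (of_int (n + 1) * h)) * cis (of_int n * \<tau>)) =
        (\<Sum>n = -L+1..L+1. of_real (f (of_int n * h)) * cis (of_int (n - 1) * \<tau>))"
      by (rule sum.reindex_bij_witness[of _ "\<lambda>n. n - 1" "\<lambda>n. n + 1"]) auto
    also have "\<dots> = (\<Sum>n = -L..L+1. of_real (f (of_int n * h)) * cis (of_int (n - 1) * \<tau>))"
    proof (rule sum.mono_neutral_left)
      have "f (of_int (-L) * h) = 0" by (rule Suc.prems) auto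
      then have "f (of_int n * h) = 0" if "n \<in> {-L..L + 1} - {-L + 1..L + 1}" for n
        using that by (cases "n = -L") auto
      then show "\<forall>n\<in>{-L..L + 1} - {-L + 1..L + 1}.
         complex_of_real (f (real_of_int n * h)) * cis (real_of_int (n - 1) * \<tau>) = 0"
        by (metis mult_zero_left of_real_0)
    qed auto
    also have "\<dots> = (\<Sum>n = -L..L. of_real (f (of_int n * h)) * cis (of_int (n - 1) * \<tau>))"
    proof (rule sum.mono_neutral_right)
      have "f (of_int (L + 1) * h) = 0" by (rule Suc.prems) auto
      then have "f (of_int n * h) = 0" if "n \<in> {-L..L + 1} - {-L..L}" for n
        using that by (cases "n = L + 1") auto
      then show "\<forall>n\<in>{-L..L + 1} - {-L..L}.
         complex_of_real (f (real_of_int n * h)) * cis (real_of_int (n - 1) * \<tau>) = 0"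
        by (metis mult_zero_left of_real_0)
    qed auto
    finally show ?thesis .
  qed simp
  have "(\<Sum>n = -L..L. of_real (fwd_diff h f (of_int n * h)) * cis (of_int n * \<tau>)) =
      (\<Sum>n = -L..L. of_real (f (of_int (n + 1) * h)) * cis (of_int n * \<tau>)) -
      (\<Sum>n = -L..L. of_real (f (of_int n * h)) * cis (of_int n * \<tau>))"
    unfolding shift by (simp only: of_real_diff left_diff_distrib sum_subtractf)
  also have "\<dots> = (\<Sum>n = -L..L. of_real (f (of_int n * h)) * (cis (of_int (n - 1) * \<tau>) - cis (of_int n * \<tau>)))"
    unfolding 1 by (simp only: right_diff_distrib sum_subtractf)
  also have "\<dots> = (cis (-\<tau>) - 1) * (\<Sum>n = -L..L. of_real (f (of_int n * h)) * cis (of_int n * \<tau>))"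
  proof -
    have "cis (of_int (n - 1) * \<tau>) - cis (of_int n * \<tau>) = (cis (-\<tau>) - 1) * cis (of_int n * \<tau>)" for n :: int
      by (simp add: left_diff_distrib cis_mult)
    then show ?thesis by (simp add: sum_distrib_left algebra_simps)
  qed
  finally have 2: "(\<Sum>n = -L..L. of_real (fwd_diff h f (of_int n * h)) * cis (of_int n * \<tau>)) =
    (cis (-\<tau>) - 1) * (\<Sum>n = -L..L. of_real (f (of_int n * h)) * cis (of_int n * \<tau>))" .
  show ?case
    using Suc.IH[of "fwd_diff h f", OF z] 2 by (simp add: funpow_swap1 mult.assoc mult.left_commute)
qed simp

lemma norm_cis_minus_1: "norm (cis (-\<tau>) - 1) = 2 * \<bar>sin (\<tau> / 2)\<bar>"
proof -
  have "(norm (cis (-\<tau>) - 1))\<^sup>2 = (cos \<tau> - 1)\<^sup>2 + (sin \<tau>)\<^sup>2"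
    by (simp add: cmod_power2)
  also have "\<dots> = 2 - 2 * cos \<tau>"
    using sin_cos_squared_add3[of \<tau>] by (simp add: power2_eq_square algebra_simps)
  also have "\<dots> = (2 * \<bar>sin (\<tau> / 2)\<bar>)\<^sup>2"
    using cos_double_sin[of "\<tau> / 2"] by (simp add: power_mult_distrib)
  finally show ?thesis
    by (metis abs_ge_zero abs_mult abs_numeral norm_ge_zero power2_eq_imp_eq)
qed

subsection \<open>Truncated power splines\<close>

text \<open>The index is the order, one more than the degree, so that for \<open>m \<ge> 1\<close>
  the derivative of \<open>tau (Suc m)\<close> off zero is \<open>tau m\<close>.
  \<open>tau 1\<close> is the Heaviside function with value 0 at 0.\<close>

definition tau :: "nat \<Rightarrow> real \<Rightarrow> real" where
  "tau m x = (if x > 0 then x ^ (m - 1) / fact (m - 1) else 0)"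

lemma tau_deriv_off_zero:
  assumes "m \<ge> 1" "x \<noteq> 0"
  shows "(tau (Suc m) has_real_derivative tau m x) (at x)"
proof (cases "x > 0")
  case True
  obtain j where j: "m = Suc j" using assms by (cases m) auto
  have "((\<lambda>x. x ^ m / fact m) has_real_derivative x ^ (m - 1) / fact (m - 1)) (at x)"
    using DERIV_cdivide[OF DERIV_pow[of m x UNIV], of "fact m"] by (simp add: j field_simps del: of_nat_Suc)
  then have "(tau (Suc m) has_real_derivative x ^ (m - 1) / fact (m - 1)) (at x)"
    by (rule has_field_derivative_transform_within_open[where S = "{0<..}"])
       (use True in \<open>auto simp: tau_def\<close>)
  then show ?thesis using True by (simp add: tau_def)
next
  case False
  have "((\<lambda>x. 0) has_real_derivative 0) (at x)" by simp
  then have "(tau (Suc m) has_real_derivative 0) (at x)"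
    by (rule has_field_derivative_transform_within_open[where S = "{..<0}"])
       (use False assms in \<open>auto simp: tau_def\<close>)
  then show ?thesis using False by (simp add: tau_def)
qed

lemma weak_deriv_tau:
  assumes "m \<ge> 1"
  shows "weak_deriv (tau (Suc m)) (tau m)"
proof -
  have "tau (Suc m) = (\<lambda>x. max x 0 ^ m / fact m)"
    using assms by (auto simp: tau_def max_def)
  moreover have "continuous_on UNIV (\<lambda>x::real. max x 0 ^ m / fact m)"
    by (intro continuous_intros) auto
  ultimately have "continuous_on UNIV (tau (Suc m))" by simp
  then show ?thesis
    unfolding weak_deriv_def using tau_deriv_off_zero[OF assms]
    by (intro conjI exI[of _ "{0}"]) auto
qed

section \<open>Chebyshev knots and their annihilating weights\<close>

definition knot :: "nat \<Rightarrow> nat \<Rightarrow> real" where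
  "knot s k = - cos (real k * pi / real s)"

text \<open>Up to a constant factor, the weights of the divided difference at the knots, which are
  the extrema of the Chebyshev polynomial of degree \<open>s\<close> on [-1, 1].\<close>

definition wt :: "nat \<Rightarrow> nat \<Rightarrow> real" where
  "wt s k = (-1) ^ k * (if k = 0 \<or> k = s then 1 else 2)"

text \<open>Again \<open>m\<close> is the order: \<open>spl s s\<close> is the spline of interest,
  smaller \<open>m\<close> gives its derivative of order \<open>s - m\<close>, and
  \<open>m = Suc s\<close> gives its antiderivative.\<close>

definition spl :: "nat \<Rightarrow> nat \<Rightarrow> real \<Rightarrow> real" where
  "spl s m x = (\<Sum>k\<le>s. wt s k * tau m (x - knot s k))"

lemma weak_deriv_spl:
  assumes "m \<ge> 1"
  shows "weak_deriv (spl s (Suc m)) (spl s m)"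
  unfolding spl_def[abs_def] diff_conv_add_uminus
  by (intro weak_deriv_sum weak_deriv_cmult weak_deriv_shift weak_deriv_tau assms)

text \<open>An inner knot borders two intervals, so its weight of modulus 2 is shared between two
  neighbouring differences; an end knot borders only one.\<close>

lemma sum_wt_telescope:
  assumes "s \<ge> 1"
  shows "(\<Sum>k\<le>s. wt s k * f k) = (\<Sum>k<s. (-1) ^ k * (f k - f (Suc k)))"
proof -
  obtain n where s: "s = Suc n" using assms by (cases s) auto
  have "(\<Sum>k\<le>s. wt s k * f k) =
      (\<Sum>k\<le>s. (-1) ^ k * f k * of_bool (k < s)) + (\<Sum>k\<le>s. (-1) ^ k * f k * of_bool (k \<ge> 1))"
    unfolding sum.distrib[symmetric] by (intro sum.cong) (auto simp: wt_def s)
  also have "(\<Sum>k\<le>s. (-1) ^ k * f k * of_bool (k < s)) = (\<Sum>k\<le>n. (-1) ^ k * f k)"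
    unfolding s sum.atMost_Suc by (auto intro!: sum.cong)
  also have "(\<Sum>k\<le>s. (-1) ^ k * f k * of_bool (k \<ge> 1)) = (\<Sum>k\<le>n. (-1) ^ Suc k * f (Suc k))"
    unfolding s sum.atMost_Suc_shift by simp
  finally show ?thesis
    unfolding s lessThan_Suc_atMost sum.distrib[symmetric] by (simp add: algebra_simps)
qed

lemma sum_abs_wt:
  assumes "s \<ge> 1"
  shows "(\<Sum>k\<le>s. \<bar>wt s k\<bar>) = 2 * real s"
proof -
  have "(\<Sum>k\<le>s. \<bar>wt s k\<bar>) = (\<Sum>k\<le>s. wt s k * (-1) ^ k)"
    by (intro sum.cong) (auto simp: wt_def abs_mult power_abs power_mult_distrib[symmetric])
  also have "\<dots> = (\<Sum>k<s. 2)"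
    unfolding sum_wt_telescope[OF assms]
    by (intro sum.cong) (auto simp: algebra_simps power_mult_distrib[symmetric])
  finally show ?thesis by simp
qed

lemma sum_alternating_telescope:
  "(\<Sum>k<n. (-1) ^ k * (u k + u (Suc k))) = (u 0 - (-1) ^ n * u n :: real)"
  by (induction n) (auto simp: algebra_simps)

text \<open>Here \<open>b\<close> is half the angle step. The factor \<open>cos b\<close>, positive
  because \<open>j < s\<close>, turns differences of cosines into sums of sines, whose alternating
  sum telescopes to a multiple of \<open>sin (j * pi)\<close>.\<close>

lemma sum_wt_cos_eq_0:
  assumes "j < s"
  shows "(\<Sum>k\<le>s. wt s k * cos (real j * (real k * pi / real s))) = 0"
proof -
  define b where "b = real j * pi / (2 * real s)"
  have arg: "real j * (real k * pi / real s) = 2 * real k * b" for k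
    using assms by (simp add: b_def field_simps)
  have "b < pi / 2" "b \<ge> 0" using assms by (auto simp: b_def field_simps)
  then have cb: "cos b > 0" by (intro cos_gt_zero_pi) auto
  have "cos b * (\<Sum>k<s. (-1) ^ k * (cos (2 * real k * b) - cos (2 * real (Suc k) * b))) =
     sin b * (\<Sum>k<s. (-1) ^ k * (sin (2 * real k * b) + sin (2 * real (Suc k) * b)))"
  proof -
    have "cos b * (cos (2 * real k * b) - cos (2 * real (Suc k) * b)) =
       sin b * (sin (2 * real k * b) + sin (2 * real (Suc k) * b))" for k
    proof -
      have e: "2 * real (Suc k) * b = 2 * real k * b + 2 * b" by (simp add: algebra_simps)
      have "cos b * (1 - cos (2 * b)) = sin b * sin (2 * b)"
        "cos b * sin (2 * b) = sin b * (1 + cos (2 * b))"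
        by (simp add: cos_double_sin sin_double power2_eq_square,
            simp add: cos_double_cos sin_double power2_eq_square)
      then show ?thesis unfolding e cos_add sin_add by algebra
    qed
    then show ?thesis
      by (simp only: sum_distrib_left mult.left_commute[of "cos b"] mult.left_commute[of "sin b"])
  qed
  also have "\<dots> = sin b * (0 - (-1) ^ s * sin (2 * real s * b))"
    by (subst sum_alternating_telescope) simp
  also have "sin (2 * real s * b) = sin (real j * pi)"
    using assms by (simp add: b_def field_simps)
  also have "\<dots> = 0" by simp
  finally have "(\<Sum>k<s. (-1) ^ k * (cos (2 * real k * b) - cos (2 * real (Suc k) * b))) = 0"
    using cb by simp
  then show ?thesis
    using assms unfolding arg by (subst sum_wt_telescope) auto
qed

lemma sum_wt_cos_eq_2s:
  assumes "s \<ge> 1"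
  shows "(\<Sum>k\<le>s. wt s k * cos (real s * (real k * pi / real s))) = 2 * real s"
proof -
  have "(\<Sum>k\<le>s. wt s k * cos (real s * (real k * pi / real s))) = (\<Sum>k\<le>s. \<bar>wt s k\<bar>)"
    using assms
    by (intro sum.cong)
       (auto simp: wt_def abs_mult power_abs power_mult_distrib[symmetric])
  then show ?thesis using sum_abs_wt[OF assms] by simp
qed

lemma cos_power_Suc_times_cos:
  assumes "j \<ge> 1"
  shows "cos x ^ Suc m * cos (real j * x) =
    (cos x ^ m * cos (real (j + 1) * x) + cos x ^ m * cos (real (j - 1) * x)) / 2"
proof -
  have 1: "real (j + 1) * x = real j * x + x" and 2: "real (j - 1) * x = real j * x - x"
    using assms by (auto simp: of_nat_diff algebra_simps)
  show ?thesis unfolding 1 2 cos_add cos_diff by (simp add: algebra_simps)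
qed

text \<open>The product-to-sum formula trades one cosine factor for the frequencies
  \<open>j + 1\<close> and \<open>j - 1\<close>, so power plus frequency stays below
  \<open>s\<close> until the power is used up.\<close>

lemma sum_wt_cos_power_eq_0:
  assumes "m + j < s"
  shows "(\<Sum>k\<le>s. wt s k * (cos (real k * pi / real s) ^ m * cos (real j * (real k * pi / real s)))) = 0"
  using assms
proof (induction m arbitrary: j)
  case 0
  then show ?case using sum_wt_cos_eq_0[of j s] by simp
next
  case (Suc m)
  show ?case
  proof (cases "j = 0")
    case True
    then show ?thesis using Suc.IH[of 1] Suc.prems by (simp add: mult.commute)
  next
    case False
    then have "cos (real k * pi / real s) ^ Suc m * cos (real j * (real k * pi / real s)) =
       (cos (real k * pi / real s) ^ m * cos (real (j + 1) * (real k * pi / real s)) +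
        cos (real k * pi / real s) ^ m * cos (real (j - 1) * (real k * pi / real s))) / 2" for k
      by (intro cos_power_Suc_times_cos) simp
    then have "(\<Sum>k\<le>s. wt s k * (cos (real k * pi / real s) ^ Suc m * cos (real j * (real k * pi / real s)))) =
      ((\<Sum>k\<le>s. wt s k * (cos (real k * pi / real s) ^ m * cos (real (j + 1) * (real k * pi / real s)))) +
       (\<Sum>k\<le>s. wt s k * (cos (real k * pi / real s) ^ m * cos (real (j - 1) * (real k * pi / real s))))) / 2"
      by (simp only: sum.distrib[symmetric] sum_divide_distrib distrib_left times_divide_eq_right)
    then show ?thesis using Suc.IH[of "j + 1"] Suc.IH[of "j - 1"] Suc.prems False by simp
  qed
qed

text \<open>When power plus frequency equals \<open>s\<close>, only the branch \<open>j + 1\<close>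
  survives, since the other falls below \<open>s\<close>. Each power therefore halves the value
  obtained at the pure frequency \<open>s\<close>.\<close>

lemma sum_wt_cos_power_top:
  assumes "m + j = s" "j \<ge> 1"
  shows "(\<Sum>k\<le>s. wt s k * (cos (real k * pi / real s) ^ m * cos (real j * (real k * pi / real s)))) =
    2 * real s / 2 ^ m"
  using assms
proof (induction m arbitrary: j)
  case 0
  then show ?case using sum_wt_cos_eq_2s[of s] by simp
next
  case (Suc m)
  then have "cos (real k * pi / real s) ^ Suc m * cos (real j * (real k * pi / real s)) =
       (cos (real k * pi / real s) ^ m * cos (real (j + 1) * (real k * pi / real s)) +
        cos (real k * pi / real s) ^ m * cos (real (j - 1) * (real k * pi / real s))) / 2" for k
    by (intro cos_power_Suc_times_cos) simp
  then have "(\<Sum>k\<le>s. wt s k * (cos (real k * pi / real s) ^ Suc m * cos (real j * (real k * pi / real s)))) =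
      ((\<Sum>k\<le>s. wt s k * (cos (real k * pi / real s) ^ m * cos (real (j + 1) * (real k * pi / real s)))) +
       (\<Sum>k\<le>s. wt s k * (cos (real k * pi / real s) ^ m * cos (real (j - 1) * (real k * pi / real s))))) / 2"
    by (simp only: sum.distrib[symmetric] sum_divide_distrib distrib_left times_divide_eq_right)
  then show ?case
    using Suc.IH[of "j + 1"] sum_wt_cos_power_eq_0[of m "j - 1" s] Suc.prems by simp
qed

lemma sum_wt_knot_power_eq_0:
  assumes "m < s"
  shows "(\<Sum>k\<le>s. wt s k * knot s k ^ m) = 0"
proof -
  have "(\<Sum>k\<le>s. wt s k * knot s k ^ m) = (-1) ^ m * (\<Sum>k\<le>s. wt s k * (cos (real k * pi / real s) ^ m * cos (real 0 * (real k * pi / real s))))"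
    unfolding knot_def power_minus[of "cos _"] by (simp add: sum_distrib_left mult_ac)
  then show ?thesis using sum_wt_cos_power_eq_0[of m 0 s] assms by simp
qed

lemma sum_wt_knot_power_top:
  assumes "even s" "s \<ge> 2"
  shows "(\<Sum>k\<le>s. wt s k * knot s k ^ s) = 4 * real s / 2 ^ s"
proof -
  obtain n where n: "s = Suc n" using assms by (cases s) auto
  \<comment> \<open>One cosine is split off as frequency 1; evenness of \<open>s\<close> removes the
    sign of the knots.\<close>
  have "(\<Sum>k\<le>s. wt s k * knot s k ^ s) = (\<Sum>k\<le>s. wt s k * (cos (real k * pi / real s) ^ n * cos (real 1 * (real k * pi / real s))))"
    using assms by (intro sum.cong) (auto simp: knot_def n)
  then show ?thesis using sum_wt_cos_power_top[of n 1 s] n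
    by (simp add: field_simps del: sum.atMost_Suc)
qed

lemma sum_wt_diff_power:
  "(\<Sum>k\<le>s. wt s k * (x - knot s k) ^ m) =
    (\<Sum>i\<le>m. of_nat (m choose i) * (-1) ^ i * x ^ (m - i) * (\<Sum>k\<le>s. wt s k * knot s k ^ i))"
proof -
  have "(x - y) ^ m = (\<Sum>i\<le>m. of_nat (m choose i) * (-1) ^ i * x ^ (m - i) * y ^ i)" for y
    using binomial_ring[of "-y" x m] by (simp add: power_minus[of y] mult_ac)
  then have "(\<Sum>k\<le>s. wt s k * (x - knot s k) ^ m) =
    (\<Sum>k\<le>s. \<Sum>i\<le>m. of_nat (m choose i) * (-1) ^ i * x ^ (m - i) * (wt s k * knot s k ^ i))"
    by (simp add: sum_distrib_left mult_ac)
  also have "\<dots> = (\<Sum>i\<le>m. \<Sum>k\<le>s. of_nat (m choose i) * (-1) ^ i * x ^ (m - i) * (wt s k * knot s k ^ i))"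
    by (rule sum.swap)
  finally show ?thesis by (simp add: sum_distrib_left)
qed

lemma sum_wt_diff_power_eq_0:
  assumes "m < s"
  shows "(\<Sum>k\<le>s. wt s k * (x - knot s k) ^ m) = 0"
  unfolding sum_wt_diff_power
  by (intro sum.neutral ballI) (use assms sum_wt_knot_power_eq_0 in auto)

lemma sum_wt_diff_power_top:
  assumes "even s" "s \<ge> 2"
  shows "(\<Sum>k\<le>s. wt s k * (x - knot s k) ^ s) = 4 * real s / 2 ^ s"
proof -
  obtain n where n: "s = Suc n" using assms by (cases s) auto
  \<comment> \<open>Moments below \<open>s\<close> vanish. Only \<open>i = s\<close> is left, and
    with it the dependence on \<open>x\<close> disappears.\<close>
  have "(\<Sum>i\<le>n. of_nat (s choose i) * (-1) ^ i * x ^ (s - i) * (\<Sum>k\<le>s. wt s k * knot s k ^ i)) = 0"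
    by (intro sum.neutral ballI) (use n sum_wt_knot_power_eq_0[of _ s] in \<open>auto simp del: sum.atMost_Suc\<close>)
  then have "(\<Sum>i\<le>s. of_nat (s choose i) * (-1) ^ i * x ^ (s - i) * (\<Sum>k\<le>s. wt s k * knot s k ^ i))
     = (\<Sum>k\<le>s. wt s k * knot s k ^ s)"
    using assms unfolding atMost_Suc[of n, folded n] by (simp add: n del: sum.atMost_Suc)
  then show ?thesis
    unfolding sum_wt_diff_power sum_wt_knot_power_top[OF assms] .
qed

lemma knot_bounds: "-1 \<le> knot s k" "knot s k \<le> 1"
  by (auto simp: knot_def)

lemma knot_0: "knot s 0 = -1"
  by (simp add: knot_def)

lemma knot_s: "s \<ge> 1 \<Longrightarrow> knot s s = 1"
  by (simp add: knot_def)

lemma knot_mono: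
  assumes "j \<le> k" "k \<le> s"
  shows "knot s j \<le> knot s k"
proof (cases "s = 0")
  case False
  have "cos (real k * pi / real s) \<le> cos (real j * pi / real s)"
    by (rule cos_monotone_0_pi_le) (use assms False in \<open>auto simp: field_simps intro!: mult_mono\<close>)
  then show ?thesis by (simp add: knot_def)
qed (simp add: knot_def)

lemma spl_eq_0_left: "x \<le> -1 \<Longrightarrow> spl s m x = 0"
  unfolding spl_def
proof (intro sum.neutral ballI)
  fix k assume "x \<le> -1"
  then have "x - knot s k \<le> 0" using knot_bounds(1)[of s k] by simp
  then show "wt s k * tau m (x - knot s k) = 0" by (simp add: tau_def)
qed

lemma spl_right:
  assumes "x > 1 \<or> x = 1 \<and> m \<ge> 2"
  shows "spl s m x = (\<Sum>k\<le>s. wt s k * (x - knot s k) ^ (m - 1)) / fact (m - 1)"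
  unfolding spl_def sum_divide_distrib
proof (rule sum.cong[OF refl])
  fix k
  show "wt s k * tau m (x - knot s k) = wt s k * (x - knot s k) ^ (m - 1) / fact (m - 1)"
    using assms knot_bounds(2)[of s k] by (cases "x = knot s k") (auto simp: tau_def)
qed

lemma spl_eq_0_right:
  assumes "x > 1 \<or> x = 1 \<and> m \<ge> 2" "1 \<le> m" "m \<le> s"
  shows "spl s m x = 0"
  using spl_right[OF assms(1)] sum_wt_diff_power_eq_0[of "m - 1" s] assms by simp

text \<open>Since \<open>spl s (Suc s)\<close> is the antiderivative vanishing at -1, this is the
  integral of the spline over [-1, 1].\<close>

lemma spl_Suc_s_at_1:
  assumes "even s" "s \<ge> 2"
  shows "spl s (Suc s) 1 = 4 / (2 ^ s * fact (s - 1))"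
proof -
  have "fact s = real s * fact (s - 1)" using assms by (simp add: fact_reduce)
  then show ?thesis
    using spl_right[of 1 "Suc s" s] sum_wt_diff_power_top[OF assms, of 1] assms
    by (simp add: field_simps)
qed

section \<open>Spline derivatives on the knot intervals\<close>

definition half_tan :: "nat \<Rightarrow> real" where
  "half_tan s = tan (pi / (2 * real s))"

lemma half_angle_facts:
  assumes "s \<ge> 6"
  shows "cos (pi / (2 * real s)) > 0" "0 < half_tan s" "half_tan s \<le> 2 / real s"
    "1 / 2 \<le> cos (pi / real s)" "sin (pi / (2 * real s)) \<le> half_tan s" "0 \<le> sin (pi / (2 * real s))"
proof -
  define x where "x = pi / (2 * real s)"
  have x: "0 < x" "x \<le> pi / 12" using assms by (auto simp: x_def field_simps)
  have x2: "x \<le> 0.3" using x pi_approx by simp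
  have sx: "0 < sin x" "sin x \<le> x" using x x2 pi_gt3 by (auto intro!: sin_gt_zero sin_x_le_x)
  have cos_lower: "cos (2 * z) \<ge> 1 - 2 * z\<^sup>2" if "0 \<le> z" "z \<le> pi" for z :: real
  proof -
    have "0 \<le> sin z" "sin z \<le> z" using that by (auto intro!: sin_ge_zero sin_x_le_x)
    then show ?thesis by (simp add: cos_double_sin power_mono)
  qed
  have "(x / 2)\<^sup>2 \<le> 0.15\<^sup>2" using x x2 by (intro power_mono) auto
  then have cx: "cos x \<ge> 0.9" using cos_lower[of "x / 2"] x x2 pi_gt3 by (simp add: power2_eq_square)
  then show "cos (pi / (2 * real s)) > 0" by (simp add: x_def)
  have T: "half_tan s = sin x / cos x" by (simp add: half_tan_def x_def tan_def)
  show "0 < half_tan s" using T sx cx by simp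
  \<comment> \<open>With \<open>x = pi / (2 * s)\<close>, the bound
    \<open>x / 0.9 \<le> 2 / s\<close> amounts to \<open>pi \<le> 3.6\<close>.\<close>
  have "sin x / cos x \<le> x / 0.9" using sx cx x by (intro frac_le) auto
  also have "\<dots> \<le> 2 / real s" using pi_approx assms by (simp add: x_def field_simps)
  finally show "half_tan s \<le> 2 / real s" using T by simp
  have "x\<^sup>2 \<le> 0.3\<^sup>2" using x x2 by (intro power_mono) auto
  then have "cos (2 * x) \<ge> 1 / 2" using cos_lower[of x] x x2 pi_gt3 by (simp add: power2_eq_square)
  then show "1 / 2 \<le> cos (pi / real s)" by (simp add: x_def)
  have "sin x * cos x \<le> sin x * 1" using sx by (intro mult_left_mono) auto
  then have "sin x \<le> sin x / cos x" using cx by (simp add: field_simps)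
  then show "sin (pi / (2 * real s)) \<le> half_tan s"
    unfolding T by (simp add: x_def)
  show "0 \<le> sin (pi / (2 * real s))" using sx by (simp add: x_def)
qed

text \<open>With \<open>y\<close> the midpoint angle, the gap is \<open>2 * sin y * sin x\<close>.
  Written as one term for each end, it lets alternating sums over the knots collapse.\<close>

lemma knot_gap:
  assumes "s \<ge> 6"
  shows "knot s (Suc k) - knot s k =
    half_tan s * sin (real k * pi / real s) + half_tan s * sin (real (Suc k) * pi / real s)"
proof -
  define x where "x = pi / (2 * real s)"
  have c: "cos x > 0" using half_angle_facts[OF assms] by (simp add: x_def)
  define y where "y = (2 * real k + 1) * x"
  have k: "real k * pi / real s = y - x" "real (Suc k) * pi / real s = y + x"
    using assms by (auto simp: x_def y_def field_simps)
  have "knot s (Suc k) - knot s k = 2 * sin y * sin x"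
    unfolding knot_def k by (simp add: cos_add cos_diff)
  also have "\<dots> = (sin x / cos x) * (sin (y - x) + sin (y + x))"
    using c by (simp add: sin_add sin_diff)
  finally show ?thesis unfolding k half_tan_def x_def tan_def by (simp add: distrib_left)
qed

lemma partial_sum_wt:
  assumes "k < s"
  shows "(\<Sum>j\<le>k. wt s j) = (-1) ^ k"
  using assms by (induction k) (auto simp: wt_def)

lemma partial_sum_wt_linear:
  assumes "k < s" "s \<ge> 6"
  shows "(\<Sum>j\<le>k. wt s j * (x - knot s j)) =
    (-1) ^ k * ((x - knot s k) - half_tan s * sin (real k * pi / real s))"
  using assms(1)
proof (induction k)
  case (Suc k)
  have "(\<Sum>j\<le>Suc k. wt s j * (x - knot s j)) =
      (-1) ^ k * ((x - knot s k) - half_tan s * sin (real k * pi / real s)) + 2 * (-1) ^ Suc k * (x - knot s (Suc k))"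
    using Suc by (simp add: wt_def)
  also have "\<dots> = (-1) ^ Suc k * ((x - knot s (Suc k)) -
      (knot s (Suc k) - knot s k - half_tan s * sin (real k * pi / real s)))"
    by (simp add: algebra_simps)
  finally show ?case unfolding knot_gap[OF assms(2)] by simp
qed (simp add: wt_def)

text \<open>Passing a knot flips the sign, so the constant terms must satisfy
  \<open>d + d' = (a'^2 - a^2) / 2\<close>. A multiple of the sine of the doubled angle solves this:
  two neighbouring values add up to an expression with the factor \<open>2 * cos (pi / s)\<close>,
  which the denominator of \<open>b\<close> cancels.\<close>

lemma partial_sum_wt_quadratic:
  assumes "k < s" "s \<ge> 6"
  defines "b \<equiv> half_tan s * (sin (pi / (2 * real s)))\<^sup>2 / (2 * cos (pi / real s))"
  shows "(\<Sum>j\<le>k. wt s j * (x - knot s j)\<^sup>2 / 2) =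
    (-1) ^ k * ((x - knot s k)\<^sup>2 / 2 - half_tan s * sin (real k * pi / real s) * (x - knot s k)
      - b * sin (2 * (real k * pi / real s)))"
  using assms(1)
proof (induction k)
  case (Suc k)
  define a where "a = half_tan s * sin (real k * pi / real s)"
  define a' where "a' = half_tan s * sin (real (Suc k) * pi / real s)"
  define d where "d = b * sin (2 * (real k * pi / real s))"
  define d' where "d' = b * sin (2 * (real (Suc k) * pi / real s))"
  have gap: "knot s (Suc k) - knot s k = a + a'"
    unfolding a_def a'_def by (rule knot_gap[OF assms(2)])
  have dd: "d + d' = (a + a') * (a' - a) / 2"
  proof -
    define z where "z = pi / (2 * real s)"
    define y where "y = (2 * real k + 1) * z"
    have s0: "real s \<noteq> 0" using assms(2) by simp
    have k: "real k * pi / real s = y - z" "real (Suc k) * pi / real s = y + z" "pi / real s = 2 * z"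
      unfolding z_def y_def using s0 by (simp_all add: field_simps)
    have c: "cos z > 0" "cos (2 * z) > 0"
      using half_angle_facts(1,4)[OF assms(2)] unfolding k(3) z_def[symmetric] by auto
    have T: "half_tan s = sin z / cos z" by (simp add: half_tan_def z_def tan_def)
    have "d + d' = b * (sin (2 * y - 2 * z) + sin (2 * y + 2 * z))"
      unfolding d_def d'_def k by (simp add: algebra_simps)
    also have "\<dots> = b * (2 * cos (2 * z)) * sin (2 * y)"
      by (simp add: sin_add sin_diff)
    also have "b * (2 * cos (2 * z)) = half_tan s * (sin z)\<^sup>2"
      unfolding b_def k(3) z_def[symmetric] using c by simp
    finally have 1: "d + d' = half_tan s * (sin z)\<^sup>2 * (2 * sin y * cos y)"
      by (simp add: sin_double)
    have 2: "a + a' = 2 * sin y * sin z"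
      unfolding a_def a'_def k T using c by (simp add: sin_add sin_diff field_simps)
    have 3: "a' - a = half_tan s * (2 * cos y * sin z)"
      unfolding a_def a'_def k by (simp add: sin_add sin_diff algebra_simps)
    show ?thesis unfolding 1 2 3 by (simp add: power2_eq_square)
  qed
  have "(\<Sum>j\<le>Suc k. wt s j * (x - knot s j)\<^sup>2 / 2) =
      (-1) ^ k * ((x - knot s k)\<^sup>2 / 2 - a * (x - knot s k) - d) + (-1) ^ Suc k * (x - knot s (Suc k))\<^sup>2"
    using Suc by (simp add: wt_def a_def d_def)
  also have "\<dots> = (-1) ^ Suc k * ((x - knot s (Suc k))\<^sup>2 -
      ((x - knot s k)\<^sup>2 / 2 - a * (x - knot s k) - d))"
    by (simp add: algebra_simps)
  also have "(x - knot s (Suc k))\<^sup>2 - ((x - knot s k)\<^sup>2 / 2 - a * (x - knot s k) - d) =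
      (x - knot s (Suc k))\<^sup>2 / 2 - a' * (x - knot s (Suc k)) - d'"
  proof -
    define v where "v = x - knot s (Suc k)"
    have "x - knot s k = v + (a + a')" using gap by (simp add: v_def)
    moreover have "d = (a + a') * (a' - a) / 2 - d'" using dd by simp
    ultimately show ?thesis unfolding v_def[symmetric] by (simp add: power2_eq_square field_simps)
  qed
  finally show ?case by (simp add: a'_def d'_def)
qed (simp add: wt_def)

text \<open>Knots to the right of \<open>x\<close> contribute nothing; the interval is closed on the
  right because \<open>tau\<close> vanishes at 0.\<close>

lemma spl_between_knots:
  assumes "k < s" "knot s k < x" "x \<le> knot s (Suc k)"
  shows "spl s m x = (\<Sum>j\<le>k. wt s j * (x - knot s j) ^ (m - 1) / fact (m - 1))"
proof -
  have "spl s m x = (\<Sum>j\<le>k. wt s j * tau m (x - knot s j))"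
    unfolding spl_def
  proof (rule sum.mono_neutral_right)
    show "\<forall>i\<in>{..s} - {..k}. wt s i * tau m (x - knot s i) = 0"
    proof
      fix i assume "i \<in> {..s} - {..k}"
      then have "knot s (Suc k) \<le> knot s i" by (intro knot_mono) auto
      then show "wt s i * tau m (x - knot s i) = 0" using assms by (simp add: tau_def)
    qed
  qed (use assms in auto)
  also have "\<dots> = (\<Sum>j\<le>k. wt s j * (x - knot s j) ^ (m - 1) / fact (m - 1))"
  proof (rule sum.cong[OF refl])
    fix j assume "j \<in> {..k}"
    then have "knot s j \<le> knot s k" using assms by (intro knot_mono) auto
    then show "wt s j * tau m (x - knot s j) = wt s j * (x - knot s j) ^ (m - 1) / fact (m - 1)"
      using assms by (simp add: tau_def)
  qed
  finally show ?thesis .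
qed

lemma ex_knot_interval:
  assumes "-1 < x" "x < 1" "s \<ge> 1"
  shows "\<exists>k<s. knot s k < x \<and> x \<le> knot s (Suc k)"
proof -
  define j where "j = (LEAST j. x \<le> knot s j)"
  have s: "x \<le> knot s s" using assms knot_s by simp
  have j: "x \<le> knot s j" "j \<le> s" unfolding j_def using s by (auto intro: LeastI Least_le)
  then have "j \<noteq> 0" using assms knot_0[of s] by (metis not_le)
  then obtain k where k: "j = Suc k" by (cases j) auto
  then have "\<not> x \<le> knot s k" using not_less_Least[of k "\<lambda>j. x \<le> knot s j"] j_def by auto
  then show ?thesis using j k by (intro exI[of _ k]) auto
qed

text \<open>On the interval after knot \<open>k\<close>, with offset \<open>u\<close> at most
  \<open>a + a'\<close>, order 1 is a pure sign and order 2 is \<open>u - a\<close> up to sign.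
  Hence the latter is at most the larger of \<open>a\<close> and \<open>a'\<close>, both bounded by
  \<open>T\<close>.\<close>

lemma spl_bounds:
  assumes s: "s \<ge> 6" and x: "-1 < x" "x < 1"
  shows "\<bar>spl s 1 x\<bar> \<le> 1" "\<bar>spl s 2 x\<bar> \<le> 2 / real s" "\<bar>spl s 3 x\<bar> \<le> 4 / (real s)\<^sup>2"
proof -
  obtain k where k: "k < s" "knot s k < x" "x \<le> knot s (Suc k)"
    using ex_knot_interval[OF x, of s] s by auto
  define T where "T = half_tan s"
  define a where "a = T * sin (real k * pi / real s)"
  define a' where "a' = T * sin (real (Suc k) * pi / real s)"
  define u where "u = x - knot s k"
  define b where "b = half_tan s * (sin (pi / (2 * real s)))\<^sup>2 / (2 * cos (pi / real s))"
  note T = half_angle_facts[OF s, folded T_def]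
  have nonneg: "0 \<le> sin (real j * pi / real s)" if "j \<le> s" for j
    by (intro sin_ge_zero) (use that s in \<open>auto simp: field_simps\<close>)
  have a: "0 \<le> a" "a \<le> T" and a': "0 \<le> a'" "a' \<le> T"
    using nonneg[of k] nonneg[of "Suc k"] k(1) T(2) unfolding a_def a'_def
    by (auto intro: mult_left_le)
  have u: "0 < u" "u \<le> a + a'"
    using knot_gap[OF s, of k] k by (auto simp: u_def a_def a'_def T_def)
  have "spl s 1 x = (-1) ^ k"
    using spl_between_knots[OF k, of 1] partial_sum_wt[OF k(1)] by simp
  then show "\<bar>spl s 1 x\<bar> \<le> 1" by (simp add: power_abs)
  have "spl s 2 x = (-1) ^ k * (u - a)"
    using spl_between_knots[OF k, of 2] partial_sum_wt_linear[OF k(1) s, of x]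
    by (simp add: u_def a_def T_def)
  then have "\<bar>spl s 2 x\<bar> = \<bar>u - a\<bar>" by (simp add: abs_mult power_abs)
  also have "\<dots> \<le> T" using a a' u by linarith
  finally show "\<bar>spl s 2 x\<bar> \<le> 2 / real s" using T(3) by linarith
  have "spl s 3 x = (-1) ^ k * (u\<^sup>2 / 2 - a * u - b * sin (2 * (real k * pi / real s)))"
    using spl_between_knots[OF k, of 3] partial_sum_wt_quadratic[OF k(1) s, of x]
    by (simp add: u_def a_def T_def b_def fact_numeral)
  then have "\<bar>spl s 3 x\<bar> = \<bar>(u\<^sup>2 / 2 - a * u) - b * sin (2 * (real k * pi / real s))\<bar>"
    by (simp add: abs_mult power_abs)
  also have "\<dots> \<le> \<bar>u\<^sup>2 / 2 - a * u\<bar> + \<bar>b * sin (2 * (real k * pi / real s))\<bar>"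
    by (rule abs_triangle_ineq4)
  also have "\<bar>u\<^sup>2 / 2 - a * u\<bar> \<le> T\<^sup>2 / 2"
  proof -
    \<comment> \<open>Completing the square leaves half a difference of two squares that both lie
      between 0 and \<open>T^2\<close>.\<close>
    have e: "u\<^sup>2 / 2 - a * u = ((u - a)\<^sup>2 - a\<^sup>2) / 2" by (simp add: power2_eq_square algebra_simps)
    have "\<bar>u - a\<bar> \<le> T" using a a' u by linarith
    then have "(u - a)\<^sup>2 \<le> T\<^sup>2" by (simp add: abs_le_square_iff[symmetric])
    moreover have "a\<^sup>2 \<le> T\<^sup>2" using a by (intro power_mono) auto
    ultimately have "\<bar>(u - a)\<^sup>2 - a\<^sup>2\<bar> \<le> T\<^sup>2"
      using zero_le_power2[of "u - a"] zero_le_power2[of a] by linarith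
    then show ?thesis unfolding e by simp
  qed
  also have "\<bar>b * sin (2 * (real k * pi / real s))\<bar> \<le> T * T\<^sup>2"
  proof -
    have "(sin (pi / (2 * real s)))\<^sup>2 \<le> T\<^sup>2" using T by (intro power_mono) auto
    then have "T * (sin (pi / (2 * real s)))\<^sup>2 / (2 * cos (pi / real s)) \<le> T * T\<^sup>2 / 1"
      using T by (intro frac_le mult_left_mono) auto
    moreover have "b \<ge> 0" unfolding b_def T_def[symmetric] using T by auto
    ultimately have "\<bar>b\<bar> \<le> T * T\<^sup>2" by (simp add: b_def T_def)
    then have "\<bar>b\<bar> * \<bar>sin (2 * (real k * pi / real s))\<bar> \<le> T * T\<^sup>2 * 1"
      by (intro mult_mono) auto
    then show ?thesis by (simp add: abs_mult)
  qed
  also have "T\<^sup>2 / 2 + T * T\<^sup>2 \<le> 1 * T\<^sup>2"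
  proof -
    have "2 / real s \<le> 1 / 2" using s by (simp add: field_simps)
    then have "T \<le> 1 / 2" using T(3) by simp
    then have "(1 / 2 + T) * T\<^sup>2 \<le> 1 * T\<^sup>2" by (intro mult_right_mono) auto
    then show ?thesis by (simp add: algebra_simps)
  qed
  also have "1 * T\<^sup>2 \<le> (2 / real s)\<^sup>2" using T by (simp add: power_mono)
  finally show "\<bar>spl s 3 x\<bar> \<le> 4 / (real s)\<^sup>2" by (simp add: power_divide)
qed

subsection \<open>Total variation\<close>

text \<open>For \<open>m \<le> s\<close>, the derivative of order \<open>s - m\<close> of \<open>x ^ l * spl s s x\<close>.\<close>

primrec mom_spl :: "nat \<Rightarrow> nat \<Rightarrow> nat \<Rightarrow> real \<Rightarrow> real" where
  "mom_spl s 0 m x = spl s m x"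
| "mom_spl s (Suc l) m x = x * mom_spl s l m x + (real s - real m) * mom_spl s l (Suc m) x"

text \<open>The recursion of \<open>mom_spl\<close> is the Leibniz rule for one more factor
  \<open>x\<close>. Differentiating that factor supplies the unit by which the coefficient grows
  from \<open>s - Suc m\<close> to \<open>s - m\<close>.\<close>

lemma weak_deriv_mom_spl:
  "m \<ge> 1 \<Longrightarrow> weak_deriv (mom_spl s l (Suc m)) (mom_spl s l m)"
proof (induction l arbitrary: m)
  case 0
  then show ?case using weak_deriv_spl[of m s] by (simp add: fun_eq_iff[symmetric])
next
  case (Suc l)
  have "weak_deriv (\<lambda>x. x * mom_spl s l (Suc m) x + (real s - real (Suc m)) * mom_spl s l (Suc (Suc m)) x)
     (\<lambda>x. (1 * mom_spl s l (Suc m) x + mom_spl s l m x * x) + (real s - real (Suc m)) * mom_spl s l (Suc m) x)"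
    by (intro weak_deriv_add weak_deriv_mult weak_deriv_id weak_deriv_cmult Suc.IH Suc.prems) simp
  moreover have "(\<lambda>x. (1 * mom_spl s l (Suc m) x + mom_spl s l m x * x) + (real s - real (Suc m)) * mom_spl s l (Suc m) x)
     = mom_spl s (Suc l) m"
    by (rule ext) (simp add: algebra_simps)
  moreover have "(\<lambda>x. x * mom_spl s l (Suc m) x + (real s - real (Suc m)) * mom_spl s l (Suc (Suc m)) x)
     = mom_spl s (Suc l) (Suc m)"
    by (rule ext) simp
  ultimately show ?case by metis
qed

lemma mom_spl_s: "mom_spl s l s x = x ^ l * spl s s x"
  by (induction l) auto

lemma mom_spl_eq_0:
  assumes "x < -1 \<or> x > 1" "m \<ge> 1" "m + l \<le> s"
  shows "mom_spl s l m x = 0"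
  using assms
  by (induction l arbitrary: m) (auto intro: spl_eq_0_left spl_eq_0_right)

text \<open>The step function carrying the jumps of \<open>mom_spl s l 1\<close>: the factor
  \<open>x ^ l\<close> scales the jump at each knot.\<close>

definition jump_part :: "nat \<Rightarrow> nat \<Rightarrow> real \<Rightarrow> real" where
  "jump_part s l x = (\<Sum>k\<le>s. wt s k * knot s k ^ l * tau 1 (x - knot s k))"

text \<open>Formally the order \<open>m = 0\<close> of the Leibniz recursion with the point masses
  at the knots removed.\<close>

primrec mom_density :: "nat \<Rightarrow> nat \<Rightarrow> real \<Rightarrow> real" where
  "mom_density s 0 x = 0"
| "mom_density s (Suc l) x = x * mom_density s l x + real s * mom_spl s l 1 x"

lemma weak_deriv_continuous_part:
  "weak_deriv (\<lambda>x. mom_spl s l 1 x - jump_part s l x) (mom_density s l)"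
proof (induction l)
  case 0
  then show ?case using weak_deriv_const[of 0] by (simp add: spl_def jump_part_def)
next
  case (Suc l)
  let ?C = "\<lambda>x. mom_spl s l 1 x - jump_part s l x"
  \<comment> \<open>\<open>x * jump_part s l x\<close> and \<open>jump_part s (Suc l) x\<close>
    differ by this continuous piecewise linear function, whose derivative is
    \<open>jump_part s l\<close>.\<close>
  have "weak_deriv (\<lambda>x. (\<Sum>k\<le>s. wt s k * knot s k ^ l * tau (Suc 1) (x + (- knot s k))))
      (\<lambda>x. (\<Sum>k\<le>s. wt s k * knot s k ^ l * tau 1 (x + (- knot s k))))"
    by (intro weak_deriv_sum weak_deriv_cmult weak_deriv_shift weak_deriv_tau) simp
  then have J: "weak_deriv (\<lambda>x. (\<Sum>k\<le>s. wt s k * knot s k ^ l * tau (Suc 1) (x - knot s k))) (jump_part s l)"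
    by (simp add: jump_part_def[abs_def])
  have *: "weak_deriv (\<lambda>x. x * ?C x + (\<Sum>k\<le>s. wt s k * knot s k ^ l * tau (Suc 1) (x - knot s k))
       + (real s - 1) * mom_spl s l (Suc 1) x)
     (\<lambda>x. (1 * ?C x + mom_density s l x * x) + jump_part s l x + (real s - 1) * mom_spl s l 1 x)"
    by (intro weak_deriv_add weak_deriv_mult weak_deriv_id weak_deriv_cmult Suc.IH J weak_deriv_mom_spl) simp
  have 1: "(\<lambda>x. x * ?C x + (\<Sum>k\<le>s. wt s k * knot s k ^ l * tau (Suc 1) (x - knot s k))
       + (real s - 1) * mom_spl s l (Suc 1) x) = (\<lambda>x. mom_spl s (Suc l) 1 x - jump_part s (Suc l) x)"
  proof
    fix x
    have "tau (Suc 1) z = z * tau 1 z" for z by (simp add: tau_def)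
    then have "(\<Sum>k\<le>s. wt s k * knot s k ^ l * tau (Suc 1) (x - knot s k)) =
       x * jump_part s l x - jump_part s (Suc l) x"
      unfolding jump_part_def sum_distrib_left sum_subtractf[symmetric]
      by (intro sum.cong) (auto simp: algebra_simps)
    then show "x * ?C x + (\<Sum>k\<le>s. wt s k * knot s k ^ l * tau (Suc 1) (x - knot s k))
       + (real s - 1) * mom_spl s l (Suc 1) x = mom_spl s (Suc l) 1 x - jump_part s (Suc l) x"
      by (simp add: algebra_simps)
  qed
  have 2: "(\<lambda>x. (1 * ?C x + mom_density s l x * x) + jump_part s l x + (real s - 1) * mom_spl s l 1 x)
     = mom_density s (Suc l)"
    by (rule ext) (simp add: algebra_simps)
  show ?case using * unfolding 1 2 .
qed

lemma mom_density_eq_0: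
  assumes "x < -1 \<or> x > 1" "l \<le> s"
  shows "mom_density s l x = 0"
  using assms(2)
proof (induction l)
  case (Suc l)
  have "mom_spl s l 1 x = 0" by (rule mom_spl_eq_0) (use assms(1) Suc in auto)
  then show ?case using Suc by simp
qed simp

text \<open>The odd primitive of \<open>3 * p * x^2 + 2 * q * |x| + r\<close>, frozen outside
  [-1, 1]; for nonnegative coefficients its total variation is
  \<open>2 * (p + q + r)\<close>.\<close>

definition env :: "real \<Rightarrow> real \<Rightarrow> real \<Rightarrow> real \<Rightarrow> real" where
  "env p q r x = (let y = max (-1) (min 1 x) in p * y ^ 3 + q * y * \<bar>y\<bar> + r * y)"

lemma abs_increment_le_env:
  assumes wd: "weak_deriv C \<phi>" and out: "\<And>x. x < -1 \<or> x > 1 \<Longrightarrow> \<phi> x = 0"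
    and bd: "\<And>x. -1 < x \<Longrightarrow> x < 1 \<Longrightarrow> \<bar>\<phi> x\<bar> \<le> 3 * p * x\<^sup>2 + 2 * q * \<bar>x\<bar> + r"
    and ab: "a \<le> b"
  shows "\<bar>C b - C a\<bar> \<le> env p q r b - env p q r a"
proof -
  obtain S where S: "finite S" "\<And>x. x \<notin> S \<Longrightarrow> (C has_real_derivative \<phi> x) (at x)"
    and cont: "continuous_on UNIV C"
    using wd unfolding weak_deriv_def by blast
  define e where "e x = (if \<bar>x\<bar> < 1 then 3 * p * x\<^sup>2 + 2 * q * \<bar>x\<bar> + r else 0)" for x
  have E: "(env p q r has_real_derivative e x) (at x)" if x: "x \<noteq> -1" "x \<noteq> 0" "x \<noteq> 1" for x
  proof (cases "\<bar>x\<bar> < 1")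
    case True
    \<comment> \<open>With the sign frozen on either side of 0, \<open>|x|\<close> becomes the
      linear function \<open>g * x\<close>.\<close>
    define g where "g = sgn x"
    have "((\<lambda>x. p * x ^ 3 + q * x * (g * x) + r * x) has_real_derivative
        3 * p * x\<^sup>2 + 2 * q * (g * x) + r) (at x)"
      by (auto intro!: derivative_eq_intros simp: power2_eq_square algebra_simps)
    then have "(env p q r has_real_derivative 3 * p * x\<^sup>2 + 2 * q * (g * x) + r) (at x)"
      by (rule has_field_derivative_transform_within_open[where S = "if x > 0 then {0<..<1} else {-1<..<0}"])
         (use True x in \<open>auto simp: env_def Let_def g_def split: if_splits\<close>)
    moreover have "g * x = \<bar>x\<bar>" by (auto simp: g_def sgn_if)
    ultimately show ?thesis using True by (simp add: e_def)
  next
    case False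
    have "((\<lambda>y. env p q r x) has_real_derivative 0) (at x)" by simp
    then have "(env p q r has_real_derivative 0) (at x)"
      by (rule has_field_derivative_transform_within_open[where S = "if x > 0 then {1<..} else {..<-1}"])
         (use False x in \<open>auto simp: env_def Let_def split: if_splits\<close>)
    then show ?thesis using False by (simp add: e_def)
  qed
  have Ec: "continuous_on UNIV (env p q r)"
    unfolding env_def[abs_def] Let_def by (intro continuous_intros)
  have le: "\<bar>\<phi> x\<bar> \<le> e x" if "x \<notin> {-1, 0, 1}" for x
  proof (cases "\<bar>x\<bar> < 1")
    case True
    then show ?thesis using bd[of x] by (auto simp: e_def)
  next
    case False
    then have "x < -1 \<or> x > 1" using that by auto
    then show ?thesis using out[of x] False by (simp add: e_def)
  qed
  \<comment> \<open>The two signs \<open>c\<close> say that the envelope plus and minus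
    \<open>C\<close> are both nondecreasing.\<close>
  have key: "env p q r a + c * C a \<le> env p q r b + c * C b" if c: "c = 1 \<or> c = -1" for c
  proof (rule nondecreasing_off_finite[OF ab, of "\<lambda>x. env p q r x + c * C x" "S \<union> {-1, 0, 1}" "\<lambda>x. e x + c * \<phi> x"])
    show "continuous_on {a..b} (\<lambda>x. env p q r x + c * C x)"
      by (intro continuous_intros continuous_on_subset[OF cont] continuous_on_subset[OF Ec]) auto
    show "finite (S \<union> {-1, 0, 1})" using S by simp
    fix x assume x: "x \<in> {a<..<b} - (S \<union> {-1, 0, 1})"
    show "((\<lambda>x. env p q r x + c * C x) has_real_derivative e x + c * \<phi> x) (at x)"
      using x S(2)[of x] E[of x] by (intro derivative_intros DERIV_cmult) auto
    show "0 \<le> e x + c * \<phi> x" using le[of x] x c by (auto simp: abs_le_iff)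
  qed
  show ?thesis using key[of 1] key[of "-1"] by (simp add: abs_le_iff)
qed

lemma env_bounds:
  assumes "p \<ge> 0" "q \<ge> 0" "r \<ge> 0"
  shows "\<bar>env p q r x\<bar> \<le> p + q + r"
proof -
  define y where "y = max (-1) (min 1 x)"
  have y: "\<bar>y\<bar> \<le> 1" by (auto simp: y_def)
  have "\<bar>env p q r x\<bar> \<le> \<bar>p * y ^ 3\<bar> + \<bar>q * y * \<bar>y\<bar>\<bar> + \<bar>r * y\<bar>"
    unfolding env_def Let_def y_def[symmetric] by linarith
  also have "\<dots> = p * \<bar>y\<bar> ^ 3 + q * (\<bar>y\<bar> * \<bar>y\<bar>) + r * \<bar>y\<bar>"
    using assms by (simp add: abs_mult power_abs)
  also have "\<dots> \<le> p * 1 + q * 1 + r * 1"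
    using assms y by (intro add_mono mult_left_mono) (auto intro: power_le_one mult_le_one simp del: abs_mult_self_eq)
  finally show ?thesis by simp
qed

lemma sum_int_telescope:
  fixes g :: "int \<Rightarrow> real"
  assumes "a \<le> b"
  shows "(\<Sum>n = a..b. g (n + 1) - g n) = g (b + 1) - g a"
  using assms
proof (induction b rule: int_ge_induct)
  case (step b)
  have "{a..b + 1} = insert (b + 1) {a..b}" using step by auto
  then show ?case using step by simp
qed simp

text \<open>\<open>A\<close> acts as a variation function: its increments over adjacent grid cells
  telescope.\<close>

lemma sum_abs_fwd_diff_le_variation:
  assumes A: "\<And>a b. a \<le> b \<Longrightarrow> \<bar>f b - f a\<bar> \<le> A b - A a" and "h \<ge> 0" "L \<ge> (0 :: int)"
    and bd: "\<And>x. lo \<le> A x" "\<And>x. A x \<le> hi"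
  shows "(\<Sum>n = -L..L. \<bar>fwd_diff h f (x + of_int n * h)\<bar>) \<le> hi - lo"
proof -
  have "(\<Sum>n = -L..L. \<bar>fwd_diff h f (x + of_int n * h)\<bar>) \<le>
      (\<Sum>n = -L..L. A (x + of_int (n + 1) * h) - A (x + of_int n * h))"
  proof (rule sum_mono)
    fix n :: int
    have "x + of_int (n + 1) * h = x + of_int n * h + h" by (simp add: algebra_simps)
    then show "\<bar>fwd_diff h f (x + of_int n * h)\<bar> \<le> A (x + of_int (n + 1) * h) - A (x + of_int n * h)"
      unfolding fwd_diff_def using A[of "x + of_int n * h" "x + of_int n * h + h"] assms(2) by (simp only: le_add_same_cancel1)
  qed
  also have "\<dots> = A (x + of_int (L + 1) * h) - A (x + of_int (-L) * h)"
    using assms by (intro sum_int_telescope[of "-L" L "\<lambda>n. A (x + of_int n * h)"]) simp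
  also have "\<dots> \<le> hi - lo" using bd(1)[of "x + of_int (-L) * h"] bd(2)[of "x + of_int (L + 1) * h"] by linarith
  finally show ?thesis .
qed

text \<open>The jumps contribute at most the sum of \<open>|wt s k|\<close>, which is
  \<open>2 * s\<close>, because the knots lie in [-1, 1]. The continuous rest contributes the
  variation of its envelope.\<close>

lemma mom_spl_variation:
  assumes s: "s \<ge> 1" "l \<le> s" and pqr: "p \<ge> 0" "q \<ge> 0" "r \<ge> 0" and "h \<ge> 0" "L \<ge> (0 :: int)"
    and bd: "\<And>x. -1 < x \<Longrightarrow> x < 1 \<Longrightarrow> \<bar>mom_density s l x\<bar> \<le> 3 * p * x\<^sup>2 + 2 * q * \<bar>x\<bar> + r"
  shows "(\<Sum>n = -L..L. \<bar>fwd_diff h (mom_spl s l 1) (x + of_int n * h)\<bar>) \<le> 2 * (real s + p + q + r)"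
proof -
  define A where "A x = (\<Sum>k\<le>s. \<bar>wt s k\<bar> * tau 1 (x - knot s k)) + env p q r x" for x
  have tau: "tau 1 a \<le> tau 1 b" if "a \<le> b" for a b using that by (auto simp: tau_def)
  have A: "\<bar>mom_spl s l 1 b - mom_spl s l 1 a\<bar> \<le> A b - A a" if ab: "a \<le> b" for a b
  proof -
    have "\<bar>jump_part s l b - jump_part s l a\<bar> \<le>
        (\<Sum>k\<le>s. \<bar>wt s k * knot s k ^ l * tau 1 (b - knot s k) - wt s k * knot s k ^ l * tau 1 (a - knot s k)\<bar>)"
      unfolding jump_part_def sum_subtractf[symmetric] by (rule sum_abs)
    also have "\<dots> \<le> (\<Sum>k\<le>s. \<bar>wt s k\<bar> * tau 1 (b - knot s k) - \<bar>wt s k\<bar> * tau 1 (a - knot s k))"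
    proof (rule sum_mono)
      fix k
      have k: "\<bar>knot s k\<bar> ^ l \<le> 1" using knot_bounds[of s k] by (intro power_le_one) auto
      have t: "0 \<le> tau 1 (b - knot s k) - tau 1 (a - knot s k)" using tau[of "a - knot s k" "b - knot s k"] ab by simp
      have "\<bar>wt s k * knot s k ^ l * tau 1 (b - knot s k) - wt s k * knot s k ^ l * tau 1 (a - knot s k)\<bar> =
          \<bar>wt s k\<bar> * \<bar>knot s k\<bar> ^ l * (tau 1 (b - knot s k) - tau 1 (a - knot s k))"
        using t by (simp add: abs_mult power_abs right_diff_distrib[symmetric])
      also have "\<dots> \<le> \<bar>wt s k\<bar> * 1 * (tau 1 (b - knot s k) - tau 1 (a - knot s k))"
        using t k by (intro mult_right_mono mult_left_mono) auto
      finally show "\<bar>wt s k * knot s k ^ l * tau 1 (b - knot s k) - wt s k * knot s k ^ l * tau 1 (a - knot s k)\<bar>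
          \<le> \<bar>wt s k\<bar> * tau 1 (b - knot s k) - \<bar>wt s k\<bar> * tau 1 (a - knot s k)"
        by (simp add: algebra_simps)
    qed
    finally have J: "\<bar>jump_part s l b - jump_part s l a\<bar> \<le> (A b - env p q r b) - (A a - env p q r a)"
      by (simp add: A_def sum_subtractf)
    have "\<bar>(mom_spl s l 1 b - jump_part s l b) - (mom_spl s l 1 a - jump_part s l a)\<bar>
        \<le> env p q r b - env p q r a"
      using abs_increment_le_env[OF weak_deriv_continuous_part mom_density_eq_0[OF _ s(2)] bd ab] .
    then show ?thesis using J by linarith
  qed
  have lo: "-(p + q + r) \<le> A x" and hi: "A x \<le> 2 * real s + (p + q + r)" for x
  proof -
    have t: "0 \<le> tau 1 z" "tau 1 z \<le> 1" for z by (auto simp: tau_def)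
    have "0 \<le> (\<Sum>k\<le>s. \<bar>wt s k\<bar> * tau 1 (x - knot s k))" using t by (intro sum_nonneg) auto
    moreover have "(\<Sum>k\<le>s. \<bar>wt s k\<bar> * tau 1 (x - knot s k)) \<le> (\<Sum>k\<le>s. \<bar>wt s k\<bar>)"
      using t by (intro sum_mono) (auto intro: mult_left_le)
    moreover have "\<bar>env p q r x\<bar> \<le> p + q + r" using env_bounds[OF pqr] .
    ultimately show "-(p + q + r) \<le> A x" "A x \<le> 2 * real s + (p + q + r)"
      unfolding A_def using sum_abs_wt[OF s(1)] by linarith+
  qed
  show ?thesis
    using sum_abs_fwd_diff_le_variation[of "mom_spl s l 1" A h L, OF A assms(6,7) lo hi, of x] by simp
qed

definition deriv_coeff :: "nat \<Rightarrow> nat \<Rightarrow> real" where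
  "deriv_coeff l s = (if l = 0 then real s else if l = 1 then 2 * real s
      else if l = 2 then 4 * real s + 1 else 9 * real s - 2)"

text \<open>The jumps account for \<open>s\<close>. The density expands into spline derivatives of
  orders 1, 2, 3 with coefficients \<open>s\<close>, \<open>s * (s - 1)\<close>,
  \<open>s * (s - 1) * (s - 2)\<close>; these products are at most \<open>s\<close>,
  \<open>2 * (s - 1)\<close>, \<open>4 * (s - 1)\<close>, and the accompanying powers of
  \<open>x\<close> determine \<open>p\<close>, \<open>q\<close>, \<open>r\<close>.\<close>

lemma mom_spl_variation_le_deriv_coeff:
  assumes s: "s \<ge> 6" and l: "l \<le> 3" and hL: "h \<ge> 0" "L \<ge> (0 :: int)"
  shows "(\<Sum>n = -L..L. \<bar>fwd_diff h (mom_spl s l 1) (x + of_int n * h)\<bar>) \<le> 2 * deriv_coeff l s"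
proof -
  have s1: "s \<ge> 1" "l \<le> s" using s l by auto
  have S: "real s \<ge> 6" using s by simp
  have b1: "real s * \<bar>spl s 1 x\<bar> \<le> real s" if "-1 < x" "x < 1" for x
    using mult_left_mono[OF spl_bounds(1)[OF s that], of "real s"] by simp
  have b2: "real s * (real s - 1) * \<bar>spl s 2 x\<bar> \<le> 2 * (real s - 1)" if "-1 < x" "x < 1" for x
  proof -
    have "real s * (real s - 1) * \<bar>spl s 2 x\<bar> \<le> real s * (real s - 1) * (2 / real s)"
      using spl_bounds(2)[OF s that] S by (intro mult_left_mono) auto
    then show ?thesis using S by simp
  qed
  have b3: "real s * (real s - 1) * (real s - 2) * \<bar>spl s 3 x\<bar> \<le> 4 * (real s - 1)" if "-1 < x" "x < 1" for x
  proof -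
    have "real s * (real s - 1) * (real s - 2) * \<bar>spl s 3 x\<bar> \<le> real s * (real s - 1) * (real s - 2) * (4 / (real s)\<^sup>2)"
      using spl_bounds(3)[OF s that] S by (intro mult_left_mono) auto
    also have "\<dots> = 4 * (real s - 1) * ((real s - 2) / real s)"
      using S by (simp add: power2_eq_square field_simps)
    also have "\<dots> \<le> 4 * (real s - 1) * 1"
      using S by (intro mult_left_mono) auto
    finally show ?thesis by simp
  qed
  consider "l = 0" | "l = 1" | "l = 2" | "l = 3" using l by linarith
  then show ?thesis
  proof cases
    case 1
    then show ?thesis
      using mom_spl_variation[OF s1, of 0 0 0, OF _ _ _ hL, of x] by (simp add: deriv_coeff_def)
  next
    case 2
    have "\<bar>mom_density s l x\<bar> \<le> 3 * 0 * x\<^sup>2 + 2 * 0 * \<bar>x\<bar> + real s" if "-1 < x" "x < 1" for x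
      using b1[OF that] by (simp add: 2 abs_mult)
    then show ?thesis
      using mom_spl_variation[OF s1, of 0 0 "real s", OF _ _ _ hL, of x] by (simp add: deriv_coeff_def 2)
  next
    case 3
    have "\<bar>mom_density s l x\<bar> \<le> 3 * 0 * x\<^sup>2 + 2 * real s * \<bar>x\<bar> + 2 * (real s - 1)" if x: "-1 < x" "x < 1" for x
    proof -
      have "mom_density s l x = 2 * x * (real s * spl s 1 x) + real s * (real s - 1) * spl s 2 x"
        by (simp add: 3 numeral_eq_Suc algebra_simps)
      also have "\<bar>\<dots>\<bar> \<le> 2 * \<bar>x\<bar> * (real s * \<bar>spl s 1 x\<bar>) + real s * (real s - 1) * \<bar>spl s 2 x\<bar>"
        using S by (intro order_trans[OF abs_triangle_ineq]) (simp add: abs_mult)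
      also have "\<dots> \<le> 2 * \<bar>x\<bar> * real s + 2 * (real s - 1)"
        using b1[OF x] b2[OF x] by (intro add_mono mult_left_mono) auto
      finally show ?thesis by (simp add: mult_ac)
    qed
    then have "(\<Sum>n = -L..L. \<bar>fwd_diff h (mom_spl s l 1) (x + of_int n * h)\<bar>) \<le> 2 * (real s + 0 + real s + 2 * (real s - 1))"
      using S by (intro mom_spl_variation[OF s1, of 0 "real s" "2 * (real s - 1)", OF _ _ _ hL]) auto
    then show ?thesis by (simp add: deriv_coeff_def 3)
  next
    case 4
    have "\<bar>mom_density s l x\<bar> \<le> 3 * real s * x\<^sup>2 + 2 * (3 * (real s - 1)) * \<bar>x\<bar> + 4 * (real s - 1)" if x: "-1 < x" "x < 1" for x
    proof -
      have "mom_density s l x = 3 * x\<^sup>2 * (real s * spl s 1 x) + 3 * x * (real s * (real s - 1) * spl s 2 x)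
          + real s * (real s - 1) * (real s - 2) * spl s 3 x"
        by (simp add: 4 numeral_eq_Suc algebra_simps)
      also have "\<bar>\<dots>\<bar> \<le> 3 * x\<^sup>2 * (real s * \<bar>spl s 1 x\<bar>) + 3 * \<bar>x\<bar> * (real s * (real s - 1) * \<bar>spl s 2 x\<bar>)
          + real s * (real s - 1) * (real s - 2) * \<bar>spl s 3 x\<bar>"
        using S by (intro order_trans[OF abs_triangle_ineq] add_mono) (simp_all add: abs_mult)
      also have "\<dots> \<le> 3 * x\<^sup>2 * real s + 3 * \<bar>x\<bar> * (2 * (real s - 1)) + 4 * (real s - 1)"
        using b1[OF x] b2[OF x] b3[OF x] by (intro add_mono mult_left_mono) auto
      finally show ?thesis by (simp add: mult_ac)
    qed
    \<comment> \<open>Half of this bound is \<open>9 * s - 7\<close>, below the coefficient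
      \<open>9 * s - 2\<close>; for \<open>l = 2\<close> it was \<open>4 * s - 2\<close>, below
      \<open>4 * s + 1\<close>.\<close>
    then have "(\<Sum>n = -L..L. \<bar>fwd_diff h (mom_spl s l 1) (x + of_int n * h)\<bar>) \<le> 2 * (real s + real s + 3 * (real s - 1) + 4 * (real s - 1))"
      using S by (intro mom_spl_variation[OF s1, of "real s" "3 * (real s - 1)" "4 * (real s - 1)", OF _ _ _ hL]) auto
    then show ?thesis by (simp add: deriv_coeff_def 4)
  qed
qed

text \<open>Climbing from the variation bound at order 1 to order \<open>s\<close> yields
  \<open>s - 1\<close> factors \<open>h\<close>.\<close>

lemma sum_abs_fwd_diff_mom_spl_le:
  assumes s: "s \<ge> 6" and l: "l \<le> 3" and hL: "h \<ge> 0" "L \<ge> (0 :: int)"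
  shows "(\<Sum>n = -L..L. \<bar>(fwd_diff h ^^ s) (\<lambda>x. x ^ l * spl s s x) (of_int n * h)\<bar>) \<le> h ^ (s - 1) * (2 * deriv_coeff l s)"
proof -
  have "(\<Sum>n = -L..L. \<bar>(fwd_diff h ^^ s) (mom_spl s l s) (0 + of_int n * h)\<bar>) \<le> h ^ (s - 1) * (2 * deriv_coeff l s)"
    by (rule sum_abs_fwd_diff_chain_le[where f = "mom_spl s l" and M = s])
       (use s mom_spl_variation_le_deriv_coeff[OF s l hL] in \<open>auto intro: weak_deriv_mom_spl hL\<close>)
  moreover have "mom_spl s l s = (\<lambda>x. x ^ l * spl s s x)" by (rule ext) (rule mom_spl_s)
  ultimately show ?thesis by simp
qed

subsection \<open>The perfect B-spline\<close>

lemma has_integral_indicator_power: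
  fixes a b x :: real
  assumes "-1 \<le> a" "a \<le> b" "-1 \<le> x"
  shows "((\<lambda>t. indicator {a<..b} t * (x - t) ^ n) has_integral
    fact n * (tau (n + 2) (x - a) - tau (n + 2) (x - b))) {-1..x}"
proof -
  \<comment> \<open>Clamping \<open>t\<close> to \<open>[a, b]\<close> produces one continuous
    primitive that is constant off the support of the indicator.\<close>
  define c where "c t = max a (min b t)" for t
  define \<Psi> where "\<Psi> t = - ((x - c t) ^ Suc n / real (Suc n))" for t
  have "((\<lambda>t. indicator {a<..b} t * (x - t) ^ n) has_integral (\<Psi> x - \<Psi> (-1))) {-1..x}"
  proof (rule fundamental_theorem_of_calculus_interior_strong[of "{a, b}"])
    show "continuous_on {-1..x} \<Psi>"
      unfolding \<Psi>_def[abs_def] c_def[abs_def] by (intro continuous_intros) auto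
    fix t assume t: "t \<in> {-1<..<x} - {a, b}"
    have "(\<Psi> has_real_derivative indicator {a<..b} t * (x - t) ^ n) (at t)"
    proof (cases "a < t \<and> t < b")
      case True
      have "((\<lambda>t. - ((x - t) ^ Suc n / real (Suc n))) has_real_derivative (x - t) ^ n) (at t)"
        by (auto intro!: derivative_eq_intros simp del: of_nat_Suc power_Suc)
      then have "(\<Psi> has_real_derivative (x - t) ^ n) (at t)"
        by (rule has_field_derivative_transform_within_open[where S = "{a<..<b}"])
           (use True in \<open>auto simp: \<Psi>_def c_def\<close>)
      then show ?thesis using True by simp
    next
      case False
      have "((\<lambda>u. \<Psi> t) has_real_derivative 0) (at t)" by simp
      then have "(\<Psi> has_real_derivative 0) (at t)"
        by (rule has_field_derivative_transform_within_open[where S = "if t < a then {..<a} else {b<..}"])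
           (use False t assms in \<open>auto simp: \<Psi>_def c_def max_def min_def\<close>)
      then show ?thesis using False t by (auto simp: indicator_def)
    qed
    then show "(\<Psi> has_vector_derivative indicator {a<..b} t * (x - t) ^ n) (at t)"
      by (simp add: has_real_derivative_iff_has_vector_derivative)
  qed (use assms in auto)
  moreover have "\<Psi> x - \<Psi> (-1) = fact n * (tau (n + 2) (x - a) - tau (n + 2) (x - b))"
  proof -
    have "c (-1) = a" using assms by (auto simp: c_def)
    moreover have "fact n * tau (n + 2) z = (if z > 0 then z ^ Suc n / real (Suc n) else 0)" for z
      by (simp add: tau_def del: of_nat_Suc power_Suc)
    moreover have "x - c x = (if x \<le> a then x - a else if x \<le> b then 0 else x - b)"
      using assms by (auto simp: c_def)
    ultimately show ?thesis
      using assms unfolding \<Psi>_def right_diff_distrib by (auto simp del: power_Suc of_nat_Suc)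
  qed
  ultimately show ?thesis by simp
qed

lemma knot_reflect:
  assumes "k \<le> s" "s \<ge> 1"
  shows "cos (real (s - k) * pi / real s) = knot s k"
proof -
  have "real (s - k) * pi / real s = pi - real k * pi / real s"
    using assms by (simp add: of_nat_diff field_simps)
  then show ?thesis by (simp add: knot_def)
qed

text \<open>Each piece integrates to a difference of truncated powers. The pieces are numbered from
  right to left and the knots from left to right; reversing the order, with \<open>s\<close> even,
  makes the signs agree.\<close>

lemma perfect_bspline_eq_spl:
  assumes "even s" "s \<ge> 2" "x \<in> {-1..1}"
  shows "perfect_bspline s x = spl s s x"
proof -
  obtain n where n: "s = n + 2" using assms by (metis add.commute le_Suc_ex)
  define c where "c k = cos (real k * pi / real s)" for k
  have cm: "-1 \<le> c (Suc k)" "c (Suc k) \<le> c k" if "k < s" for k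
  proof -
    show "-1 \<le> c (Suc k)" by (simp add: c_def)
    have "real (Suc k) * pi \<le> real s * pi" using that by (intro mult_right_mono) auto
    then show "c (Suc k) \<le> c k"
      unfolding c_def by (intro cos_monotone_0_pi_le) (use that in \<open>auto simp: field_simps\<close>)
  qed
  have has_int: "((\<lambda>t. \<Sum>k<s. (-1) ^ k * (indicator {c (Suc k)<..c k} t * (x - t) ^ n)) has_integral
     (\<Sum>k<s. (-1) ^ k * (fact n * (tau s (x - c (Suc k)) - tau s (x - c k))))) {-1..x}"
    unfolding n
    by (intro has_integral_sum has_integral_mult_right has_integral_indicator_power)
       (use cm assms n in auto)
  have set: "{0..s - 1} = {..<s}" and sn: "s - 2 = n" using n by auto
  have "integral {-1..x} (\<lambda>t. (\<Sum>k = 0..s - 1. (-1) ^ k * indicator {c (k + 1) <.. c k} t) * (x - t) ^ (s - 2))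
     = (\<Sum>k<s. (-1) ^ k * (fact n * (tau s (x - c (Suc k)) - tau s (x - c k))))"
    unfolding set sn Suc_eq_plus1[symmetric] sum_distrib_right mult.assoc
    by (rule integral_unique[OF has_int])
  then have "perfect_bspline s x = (-1) ^ (s - 1) / fact (s - 2) *
     (\<Sum>k<s. (-1) ^ k * (fact n * (tau s (x - c (Suc k)) - tau s (x - c k))))"
    unfolding perfect_bspline_def c_def using assms(3) by simp
  also have "\<dots> = (\<Sum>k<s. (-1) ^ Suc k * (tau s (x - c (Suc k)) - tau s (x - c k)))"
    using assms(1) by (simp add: n sum_distrib_left sum_negf[symmetric] mult.left_commute algebra_simps)
  also have "\<dots> = (\<Sum>i<s. (-1) ^ Suc (s - Suc i) * (tau s (x - c (Suc (s - Suc i))) - tau s (x - c (s - Suc i))))"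
    by (rule sum.nat_diff_reindex[symmetric])
  also have "\<dots> = (\<Sum>i<s. (-1) ^ i * (tau s (x - knot s i) - tau s (x - knot s (Suc i))))"
  proof (rule sum.cong[OF refl])
    fix i assume i: "i \<in> {..<s}"
    then have e: "Suc (s - Suc i) = s - i" by auto
    have "(-1) ^ (s - i) = ((-1) ^ i :: real)"
      using i assms(1) by (auto simp: minus_one_power_iff)
    then show "(-1) ^ Suc (s - Suc i) * (tau s (x - c (Suc (s - Suc i))) - tau s (x - c (s - Suc i))) =
        (-1) ^ i * (tau s (x - knot s i) - tau s (x - knot s (Suc i)))"
      unfolding e using i assms knot_reflect[of i s] knot_reflect[of "Suc i" s] by (simp add: c_def)
  qed
  also have "\<dots> = spl s s x"
    unfolding spl_def using assms by (subst sum_wt_telescope) auto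
  finally show ?thesis .
qed

section \<open>Averaging over aliased frequencies\<close>

lemma sum_cis_roots_of_unity:
  fixes n :: int and R :: nat and t :: real
  assumes "R \<ge> 1"
  shows "(\<Sum>j<R. cis (of_int n * ((t + 2 * pi * (real j - real p)) / real R))) =
    (if int R dvd n then of_nat R * cis (of_int n * t / real R) else 0)"
proof -
  \<comment> \<open>Every term is a common phase times a power of this \<open>R\<close>-th root of
    unity, which is 1 exactly when \<open>R\<close> divides \<open>n\<close>.\<close>
  define z where "z = cis (2 * pi * of_int n / real R)"
  have split: "cis (of_int n * ((t + 2 * pi * (real j - real p)) / real R)) =
      cis (of_int n * (t - 2 * pi * real p) / real R) * z ^ j" for j
    unfolding z_def Complex.DeMoivre cis_mult
    by (rule arg_cong[of _ _ cis]) (use assms in \<open>simp add: field_simps\<close>)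
  have zR: "z ^ R = 1"
    unfolding z_def Complex.DeMoivre using assms cis_multiple_2pi[of "of_int n"] by (simp add: mult_ac)
  show ?thesis
  proof (cases "int R dvd n")
    case True
    then obtain k where k: "n = int R * k" by auto
    have "z = 1" unfolding z_def using assms cis_multiple_2pi[of "of_int k"] by (simp add: k mult_ac)
    \<comment> \<open>For \<open>n = R * k\<close> the centring shift by \<open>p\<close> changes
      the phase by a multiple of \<open>2 * pi\<close>.\<close>
    moreover have "cis (of_int n * (t - 2 * pi * real p) / real R) = cis (of_int n * t / real R)"
    proof -
      have "of_int n * (t - 2 * pi * real p) / real R = of_int n * t / real R + 2 * pi * of_int (- k * int p)"
        using assms by (simp add: k field_simps)
      then show ?thesis
        using cis_multiple_2pi[of "of_int (- k * int p)"] by (metis Ints_of_int cis_mult mult.right_neutral)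
    qed
    ultimately show ?thesis using True unfolding split by simp
  next
    case False
    have "z \<noteq> 1"
    proof
      assume "z = 1"
      then have "cos (2 * pi * of_int n / real R) = 1" by (simp add: z_def complex_eq_iff)
      then obtain m :: int where "2 * pi * of_int n / real R = of_int m * 2 * pi"
        using cos_one_2pi_int by auto
      then have "real_of_int n = of_int (int R * m)" using assms by (simp add: field_simps)
      then have "n = int R * m" by (simp only: of_int_eq_iff)
      then show False using False by simp
    qed
    then have "(\<Sum>j<R. z ^ j) = 0" using zR by (simp add: geometric_sum)
    then show ?thesis using False unfolding split sum_distrib_left[symmetric] by simp
  qed
qed

text \<open>An exact finite substitute for Poisson summation.\<close>

lemma sum_grid_refinement:
  fixes F :: "real \<Rightarrow> real" and L :: int
  assumes F: "\<And>x. \<bar>x\<bar> \<ge> 1 \<Longrightarrow> F x = 0" and R: "R \<ge> 1" and L: "L \<ge> int (Suc N) * int R"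
  shows "(\<Sum>j<R. \<Sum>n = -L..L. of_real (F (of_int n * (1 / (real (Suc N) * real R))))
      * cis (of_int n * ((t + 2 * pi * (real j - real p)) / real R))) =
    of_nat R * (\<Sum>k = -int N..int N. of_real (F (of_int k / real (Suc N))) * cis (of_int k * t))"
    (is "?lhs = _")
proof -
  define a where "a n = of_real (F (of_int n * (1 / (real (Suc N) * real R)))) *
     (if int R dvd n then of_nat R * cis (of_int n * t / real R) else 0 :: complex)" for n
  have "?lhs = (\<Sum>n = -L..L. \<Sum>j<R. of_real (F (of_int n * (1 / (real (Suc N) * real R))))
      * cis (of_int n * ((t + 2 * pi * (real j - real p)) / real R)))"
    by (rule sum.swap)
  also have "\<dots> = (\<Sum>n = -L..L. a n)"
    unfolding sum_distrib_left[symmetric] sum_cis_roots_of_unity[OF R] a_def by (rule refl)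
  \<comment> \<open>Only multiples \<open>R * k\<close> survive, and those with
    \<open>|k| > N\<close> sit at points of modulus at least 1, where \<open>F\<close>
    vanishes.\<close>
  also have "\<dots> = (\<Sum>n\<in>(\<lambda>k. int R * k) ` {-int N..int N}. a n)"
  proof (rule sum.mono_neutral_right)
    show "(\<lambda>k. int R * k) ` {-int N..int N} \<subseteq> {-L..L}"
    proof
      fix n assume "n \<in> (\<lambda>k. int R * k) ` {-int N..int N}"
      then obtain k where k: "n = int R * k" "k \<in> {-int N..int N}" by blast
      have "\<bar>n\<bar> = int R * \<bar>k\<bar>" using k by (simp add: abs_mult)
      also have "\<dots> \<le> int R * int (Suc N)" using k by (intro mult_left_mono) auto
      finally have "\<bar>n\<bar> \<le> L" using L by (simp add: mult.commute)
      then show "n \<in> {-L..L}" by auto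
    qed
    show "\<forall>n\<in>{-L..L} - (\<lambda>k. int R * k) ` {-int N..int N}. a n = 0"
    proof
      fix n assume n: "n \<in> {-L..L} - (\<lambda>k. int R * k) ` {-int N..int N}"
      show "a n = 0"
      proof (cases "int R dvd n")
        case True
        then obtain k where k: "n = int R * k" by auto
        then have "k \<notin> {-int N..int N}" using n by auto
        then have "\<bar>k\<bar> \<ge> int (Suc N)" by auto
        then have "real_of_int \<bar>k\<bar> \<ge> real (Suc N)" by linarith
        then have "\<bar>of_int n * (1 / (real (Suc N) * real R))\<bar> \<ge> 1"
          using R by (simp add: k abs_mult del: of_nat_Suc)
        then show ?thesis using F by (simp add: a_def del: of_nat_Suc)
      qed (simp add: a_def)
    qed
  qed simp
  also have "\<dots> = (\<Sum>k = -int N..int N. a (int R * k))"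
    by (subst sum.reindex) (use R in \<open>auto simp: inj_on_def\<close>)
  also have "\<dots> = of_nat R * (\<Sum>k = -int N..int N. of_real (F (of_int k / real (Suc N))) * cis (of_int k * t))"
    unfolding sum_distrib_left
    by (rule sum.cong[OF refl]) (use R in \<open>simp add: a_def field_simps del: of_nat_Suc\<close>)
  finally show ?thesis .
qed

subsection \<open>Aliased frequencies\<close>

lemma spl_s_eq_0_outside:
  assumes "\<bar>x\<bar> \<ge> 1" "s \<ge> 2"
  shows "spl s s x = 0"
proof (cases "x \<le> -1")
  case False
  then have "x > 1 \<or> x = 1 \<and> s \<ge> 2" using assms by auto
  then show ?thesis using assms by (intro spl_eq_0_right) auto
qed (rule spl_eq_0_left)

text \<open>Summation by parts of order \<open>s\<close> multiplies the sum by a factor of modulus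
  \<open>(2 * |sin (\<tau> / 2)|) ^ s\<close>. The excess of \<open>L\<close> over \<open>K\<close>
  is the margin that it consumes.\<close>

lemma norm_spl_exp_sum_le:
  assumes s: "s \<ge> 6" and l: "l \<le> 3" and K: "K \<ge> (1 :: nat)" and L: "L \<ge> int K + int s"
    and nz: "sin (\<tau> / 2) \<noteq> 0"
  defines "F \<equiv> (\<lambda>x. x ^ l * spl s s x)"
  shows "norm (\<Sum>n = -L..L. of_real (F (of_int n * (1 / real K))) * cis (of_int n * \<tau>))
    \<le> (1 / real K) ^ (s - 1) * (2 * deriv_coeff l s) / (2 * \<bar>sin (\<tau> / 2)\<bar>) ^ s"
proof -
  define h where "h = 1 / real K"
  define S where "S = (\<Sum>n = -L..L. of_real (F (of_int n * h)) * cis (of_int n * \<tau>))"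
  have F0: "F (of_int n * h) = 0" if "n \<notin> {-L + int s..L}" for n
  proof -
    have "\<bar>n\<bar> \<ge> int K" using that L by auto
    then have "\<bar>real_of_int n\<bar> \<ge> real K" by linarith
    then have "\<bar>of_int n * h\<bar> \<ge> 1"
      using K by (auto simp: h_def abs_mult field_simps)
    then show ?thesis using spl_s_eq_0_outside[of "of_int n * h" s] s by (simp add: F_def)
  qed
  have "(2 * \<bar>sin (\<tau> / 2)\<bar>) ^ s * norm S = norm ((cis (-\<tau>) - 1) ^ s * S)"
    by (simp add: norm_mult norm_power norm_cis_minus_1)
  also have "\<dots> = norm (\<Sum>n = -L..L. of_real ((fwd_diff h ^^ s) F (of_int n * h)) * cis (of_int n * \<tau>))"
    unfolding S_def using sum_fwd_diff_exp[of L s F h \<tau>] F0 by simp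
  also have "\<dots> \<le> (\<Sum>n = -L..L. \<bar>(fwd_diff h ^^ s) F (of_int n * h)\<bar>)"
    by (rule sum_norm_le) (simp add: norm_mult)
  also have "\<dots> \<le> h ^ (s - 1) * (2 * deriv_coeff l s)"
    unfolding F_def by (rule sum_abs_fwd_diff_mom_spl_le[OF s l]) (use L in \<open>auto simp: h_def\<close>)
  finally show ?thesis
    using nz by (simp add: S_def h_def pos_le_divide_eq mult.commute)
qed

text \<open>With \<open>R = 2 * p + 1\<close>, this is \<open>R\<close> times the distance on the
  unit circle between angles 0 and \<open>x / R\<close>. Odd \<open>R\<close> lets the aliases be
  numbered symmetrically from \<open>-p\<close> to \<open>p\<close>.\<close>

definition chord :: "nat \<Rightarrow> real \<Rightarrow> real" where
  "chord p x = 2 * real (2 * p + 1) * \<bar>sin (x / (2 * real (2 * p + 1)))\<bar>"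

text \<open>Jordan's inequality, from the concavity of the sine.\<close>

lemma sin_ge_linear:
  fixes u :: real
  assumes "0 \<le> u" "u \<le> pi / 2"
  shows "2 * u / pi \<le> sin u"
proof -
  have "concave_on {0..pi / 2} sin"
    by (rule f''_le0_imp_concave[where f' = cos and f'' = "\<lambda>x. - sin x"])
       (auto intro!: derivative_eq_intros sin_ge_zero)
  from concave_onD[OF this, of "2 * u / pi" 0 "pi / 2"] show ?thesis
    using assms by (simp add: field_simps)
qed

text \<open>Jordan's inequality at the half angle; the bound is free of \<open>p\<close>, which
  keeps later estimates uniform in the refinement.\<close>

lemma chord_lower:
  assumes "\<bar>x\<bar> \<le> pi * real (2 * p + 1)"
  shows "2 * \<bar>x\<bar> / pi \<le> chord p x"
proof -
  define R where "R = real (2 * p + 1)"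
  have R: "R > 0" by (simp add: R_def)
  have "2 * (\<bar>x\<bar> / (2 * R)) / pi \<le> sin (\<bar>x\<bar> / (2 * R))"
    using assms R unfolding R_def[symmetric] by (intro sin_ge_linear) (auto simp: field_simps)
  also have "\<dots> \<le> \<bar>sin (x / (2 * R))\<bar>" by (cases "x \<ge> 0") auto
  finally have "2 * R * (2 * (\<bar>x\<bar> / (2 * R)) / pi) \<le> 2 * R * \<bar>sin (x / (2 * R))\<bar>"
    using R by (intro mult_left_mono) auto
  then show ?thesis using R unfolding chord_def R_def[symmetric] by simp
qed

lemma chord_tendsto: "(\<lambda>p. chord p x) \<longlonglongrightarrow> \<bar>x\<bar>"
proof -
  have "(\<lambda>p. 2 * real (2 * p + 1) * sin (x / (2 * real (2 * p + 1)))) \<longlonglongrightarrow> x"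
    by real_asymp
  from tendsto_rabs[OF this] show ?thesis by (simp add: chord_def abs_mult)
qed

text \<open>Comparison with the telescoping series of \<open>1 / (r * (r + 1))\<close>, once for
  each sign of \<open>r\<close>.\<close>

lemma sum_symmetric_tail_le:
  fixes f :: "int \<Rightarrow> real"
  assumes f: "\<And>r. m < \<bar>r\<bar> \<Longrightarrow> \<bar>r\<bar> \<le> p \<Longrightarrow> f r \<le> c * (1 / of_int \<bar>r\<bar> - 1 / of_int (\<bar>r\<bar> + 1))"
    and c: "c \<ge> 0" and m: "m \<ge> 0"
  shows "(\<Sum>r\<in>{-p..p} - {-m..m}. f r) \<le> 2 * c / of_int (m + 1)"
proof -
  have half: "(\<Sum>r = m + 1..p. g r) \<le> c / of_int (m + 1)"
    if g: "\<And>r. m < r \<Longrightarrow> r \<le> p \<Longrightarrow> g r \<le> c * (1 / of_int r - 1 / of_int (r + 1))" for g :: "int \<Rightarrow> real"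
  proof (cases "m + 1 \<le> p")
    case True
    have "(\<Sum>r = m + 1..p. g r) \<le> (\<Sum>r = m + 1..p. (- c / of_int (r + 1)) - (- c / of_int r))"
      by (intro sum_mono order_trans[OF g]) (auto simp: algebra_simps)
    also have "\<dots> = - c / of_int (p + 1) - (- c / of_int (m + 1))"
      by (rule sum_int_telescope[OF True, of "\<lambda>r. - c / of_int r"])
    also have "\<dots> \<le> c / of_int (m + 1)" using c True m by simp
    finally show ?thesis .
  qed (use c m in simp)
  have "{-p..p} - {-m..m} = {m + 1..p} \<union> {-p..-m - 1}" using m by auto
  moreover have "{m + 1..p} \<inter> {-p..-m - 1} = {}" using m by auto
  ultimately have "(\<Sum>r\<in>{-p..p} - {-m..m}. f r) = (\<Sum>r = m + 1..p. f r) + (\<Sum>r = -p..-m - 1. f r)"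
    by (simp add: sum.union_disjoint)
  also have "(\<Sum>r = -p..-m - 1. f r) = (\<Sum>r = m + 1..p. f (-r))"
    by (rule sum.reindex_bij_witness[of _ uminus uminus]) auto
  also have "(\<Sum>r = m + 1..p. f r) + (\<Sum>r = m + 1..p. f (-r)) \<le> c / of_int (m + 1) + c / of_int (m + 1)"
    using m by (intro add_mono half order_trans[OF f]) auto
  finally show ?thesis by simp
qed

lemma sum_centered_reindex:
  fixes g :: "real \<Rightarrow> 'a :: comm_monoid_add"
  shows "(\<Sum>j<2 * p + 1. g (real j - real p)) = (\<Sum>r = -int p..int p. g (of_int r))"
  by (rule sum.reindex_bij_witness[of _ "\<lambda>r. nat (r + int p)" "\<lambda>j. int j - int p"]) auto

text \<open>Only the two aliases nearest to zero matter, and for \<open>\<bar>t\<bar> = pi\<close> both of them contribute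
  fully.\<close>

lemma central_aliases_le:
  fixes t :: real
  assumes t: "t \<noteq> 0" "\<bar>t\<bar> \<le> pi" and s: "s \<ge> 6"
  shows "(\<Sum>r = -2..2::int. (\<bar>t\<bar> / \<bar>t + 2 * pi * of_int r\<bar>) ^ s) \<le> 2.005"
proof -
  \<comment> \<open>Three of the five aliases have modulus at least \<open>3 * |t|\<close>, and
    \<open>2 + 3 / 729 < 2.005\<close>.\<close>
  have small: "x ^ s \<le> 1 / 729" if "0 \<le> x" "x \<le> 1 / 3" for x :: real
  proof -
    have "x ^ s \<le> x ^ 6" using that s by (intro power_decreasing) auto
    also have "\<dots> \<le> (1 / 3) ^ 6" using that by (intro power_mono) auto
    finally show ?thesis by (simp add: power_divide)
  qed
  have one: "x ^ s \<le> 1" if "0 \<le> x" "x \<le> 1" for x :: real using that by (rule power_le_one)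
  have set: "{-2..2::int} = {-2, -1, 0, 1, 2}" by auto
  have far: "(\<bar>t\<bar> / \<bar>y\<bar>) ^ s \<le> 1 / 729" if "\<bar>y\<bar> \<ge> 3 * \<bar>t\<bar>" for y
    using that t by (intro small) (auto simp: field_simps)
  have near: "(\<bar>t\<bar> / \<bar>y\<bar>) ^ s \<le> 1" if "\<bar>y\<bar> \<ge> \<bar>t\<bar>" for y
    using that t by (intro one) (auto simp: field_simps)
  show ?thesis
  proof (cases "t > 0")
    case True
    show ?thesis unfolding set
      using far[of "t - 4 * pi"] far[of "t + 4 * pi"] far[of "t + 2 * pi"] near[of "t - 2 * pi"] near[of t] t True
      by simp
  next
    case False
    show ?thesis unfolding set
      using far[of "t - 4 * pi"] far[of "t + 4 * pi"] far[of "t - 2 * pi"] near[of "t + 2 * pi"] near[of t] t False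
      by simp
  qed
qed

text \<open>The number of terms grows with \<open>p\<close>, so the bound must be uniform:
  \<open>chord_lower\<close> and \<open>pi < 3.2\<close> make each ratio at most
  \<open>1.6 / (2 * a - 1)\<close> with \<open>a = |r|\<close>.\<close>

lemma far_aliases_le:
  fixes t :: real
  assumes t: "t \<noteq> 0" "\<bar>t\<bar> \<le> pi" and s: "s \<ge> 6"
  shows "(\<Sum>r\<in>{-int p..int p} - {-2..2}. (\<bar>t\<bar> / chord p (t + 2 * pi * of_int r)) ^ s) \<le> 0.01"
proof -
  have "(\<bar>t\<bar> / chord p (t + 2 * pi * of_int r)) ^ s
      \<le> 0.0135 * (1 / of_int \<bar>r\<bar> - 1 / of_int (\<bar>r\<bar> + 1))" if r: "2 < \<bar>r\<bar>" "\<bar>r\<bar> \<le> int p" for r :: int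
  proof -
    define a where "a = real_of_int \<bar>r\<bar>"
    have "3 \<le> \<bar>r\<bar>" using r by simp
    then have a: "a \<ge> 3" "a \<le> real p" using r unfolding a_def by linarith+
    define x where "x = t + 2 * pi * of_int r"
    have ar: "\<bar>2 * pi * of_int r\<bar> = 2 * pi * a" by (simp add: a_def abs_mult)
    have "\<bar>x\<bar> \<le> \<bar>t\<bar> + \<bar>2 * pi * of_int r\<bar>" unfolding x_def by (rule abs_triangle_ineq)
    also have "\<dots> \<le> pi + 2 * pi * real p" unfolding ar using t a by (intro add_mono mult_left_mono) auto
    finally have xu: "\<bar>x\<bar> \<le> pi * real (2 * p + 1)" by (simp add: algebra_simps)
    have "\<bar>x\<bar> \<ge> 2 * pi * a - pi" using t ar unfolding x_def by linarith
    then have xl: "\<bar>x\<bar> \<ge> pi * (2 * a - 1)" by (simp add: algebra_simps)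
    have "2 * (2 * a - 1) = 2 * (pi * (2 * a - 1)) / pi" by simp
    also have "\<dots> \<le> 2 * \<bar>x\<bar> / pi" using xl by (intro divide_right_mono mult_left_mono) auto
    also have "\<dots> \<le> chord p x" by (rule chord_lower[OF xu])
    finally have ch: "2 * (2 * a - 1) \<le> chord p x" .
    define \<rho> where "\<rho> = \<bar>t\<bar> / chord p x"
    have "\<rho> \<le> 3.2 / (2 * (2 * a - 1))"
      unfolding \<rho>_def using ch a t pi_approx by (intro frac_le) auto
    also have "\<dots> = 1.6 / (2 * a - 1)" using a by (simp add: field_simps)
    finally have \<rho>: "\<rho> \<le> 1.6 / (2 * a - 1)" .
    have \<rho>0: "0 \<le> \<rho>" unfolding \<rho>_def using ch a by (intro divide_nonneg_nonneg) auto
    have "1.6 / (2 * a - 1) \<le> 1.6 / 5" using a by (intro frac_le) auto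
    then have \<rho>1: "\<rho> \<le> 0.32" using \<rho> by simp
    have "\<rho> ^ s \<le> \<rho> ^ 6" using s \<rho>0 \<rho>1 by (intro power_decreasing) auto
    \<comment> \<open>Four powers yield the small constant \<open>0.32 ^ 4\<close>, and two keep the
      quadratic decay needed for telescoping. The total is at most
      \<open>2 * 0.0135 / 3 = 0.009\<close>.\<close>
    also have "\<dots> = \<rho> ^ 4 * \<rho> ^ 2" by (simp flip: power_add)
    also have "\<dots> \<le> 0.32 ^ 4 * (1.6 / (2 * a - 1)) ^ 2"
      using \<rho> \<rho>0 \<rho>1 by (intro mult_mono power_mono) auto
    also have "(1.6 / (2 * a - 1)) ^ 2 = 2.56 / (2 * a - 1)\<^sup>2" unfolding power_divide by (simp add: power2_eq_square)
    also have "\<dots> \<le> 2.56 / (2 * (a * (a + 1)))"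
    proof (rule divide_left_mono)
      have "0 \<le> 2 * a * (a - 3)" using a by simp
      then show "2 * (a * (a + 1)) \<le> (2 * a - 1)\<^sup>2" by (simp add: power2_eq_square algebra_simps)
    qed (use a in auto)
    also have "0.32 ^ 4 * (2.56 / (2 * (a * (a + 1)))) = (0.32 ^ 4 * 1.28) * (1 / a - 1 / (a + 1))"
    proof -
      have "1 / a - 1 / (a + 1) = 1 / (a * (a + 1))" using a by (simp add: field_simps)
      then show ?thesis by (simp only: mult.assoc) simp
    qed
    also have "\<dots> \<le> 0.0135 * (1 / a - 1 / (a + 1))"
      using a by (intro mult_right_mono) (auto simp: field_simps)
    finally show ?thesis unfolding \<rho>_def x_def a_def by simp
  qed
  from sum_symmetric_tail_le[of 2 "int p", OF this] show ?thesis by simp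
qed

text \<open>Only the five central terms are taken to the limit
  \<open>p \<rightarrow> \<infinity>\<close>; all others together stay below 0.01 for every
  \<open>p\<close>, and \<open>2.005 + 0.01 < 2.02\<close>.\<close>

lemma alias_sum_limit:
  fixes t :: real
  assumes t: "t \<noteq> 0" "\<bar>t\<bar> \<le> pi" and s: "s \<ge> 6" and W: "W \<ge> 0"
    and Y: "\<And>p. Y \<le> W * (\<Sum>r = -int p..int p. 1 / chord p (t + 2 * pi * of_int r) ^ s)"
  shows "Y \<le> W * 2.02 / \<bar>t\<bar> ^ s"
proof -
  define Z where "Z p = (\<Sum>r = -2..2::int. (\<bar>t\<bar> / chord p (t + 2 * pi * of_int r)) ^ s)" for p
  have le: "Y * \<bar>t\<bar> ^ s \<le> W * (Z p + 0.01)" if p: "p \<ge> 2" for p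
  proof -
    have "Y * \<bar>t\<bar> ^ s \<le> W * (\<Sum>r = -int p..int p. 1 / chord p (t + 2 * pi * of_int r) ^ s) * \<bar>t\<bar> ^ s"
      using Y by (intro mult_right_mono) auto
    also have "\<dots> = W * (\<Sum>r = -int p..int p. (\<bar>t\<bar> / chord p (t + 2 * pi * of_int r)) ^ s)"
      by (simp add: sum_distrib_right mult.assoc power_divide)
    also have "(\<Sum>r = -int p..int p. (\<bar>t\<bar> / chord p (t + 2 * pi * of_int r)) ^ s) =
        (\<Sum>r\<in>{-int p..int p} - {-2..2}. (\<bar>t\<bar> / chord p (t + 2 * pi * of_int r)) ^ s) + Z p"
      unfolding Z_def using p by (intro sum.subset_diff) auto
    also have "W * \<dots> \<le> W * (0.01 + Z p)"
      using W far_aliases_le[OF t s, of p] by (intro mult_left_mono add_right_mono)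
    finally show ?thesis by (simp add: add.commute)
  qed
  have nz: "t + 2 * pi * of_int r \<noteq> 0" for r :: int
  proof
    assume "t + 2 * pi * of_int r = 0"
    then have "\<bar>t\<bar> = \<bar>2 * pi * of_int r\<bar>" by linarith
    then have e: "\<bar>t\<bar> = 2 * pi * of_int \<bar>r\<bar>" by (simp add: abs_mult)
    show False
    proof (cases "r = 0")
      case True then show False using e t by simp
    next
      case False
      then have "of_int \<bar>r\<bar> \<ge> (1 :: real)" by simp
      then have "2 * pi * of_int \<bar>r\<bar> \<ge> 2 * pi * 1" by (intro mult_left_mono) auto
      then show False using e t pi_gt_zero by linarith
    qed
  qed
  have "(\<lambda>p. W * (Z p + 0.01)) \<longlonglongrightarrow>
      W * ((\<Sum>r = -2..2::int. (\<bar>t\<bar> / \<bar>t + 2 * pi * of_int r\<bar>) ^ s) + 0.01)"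
    unfolding Z_def by (intro tendsto_intros chord_tendsto) (use nz in auto)
  then have "Y * \<bar>t\<bar> ^ s \<le> W * ((\<Sum>r = -2..2::int. (\<bar>t\<bar> / \<bar>t + 2 * pi * of_int r\<bar>) ^ s) + 0.01)"
    by (rule LIMSEQ_le_const) (use le in blast)
  also have "\<dots> \<le> W * 2.02"
    using central_aliases_le[OF t s] W by (intro mult_left_mono) auto
  finally show ?thesis using t by (simp add: field_simps)
qed

text \<open>The window exceeds the support of the spline by \<open>s\<close> grid points, the margin
  for summation by parts.\<close>

definition alias_term :: "nat \<Rightarrow> nat \<Rightarrow> nat \<Rightarrow> nat \<Rightarrow> real \<Rightarrow> int \<Rightarrow> complex" where
  "alias_term s l N p t r = (let L = int (Suc N * (2 * p + 1)) + int s; h = 1 / real (Suc N * (2 * p + 1)) in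
     (\<Sum>n = -L..L. of_real ((of_int n * h) ^ l * spl s s (of_int n * h)) *
       cis (of_int n * ((t + 2 * pi * of_int r) / real (2 * p + 1)))))"

lemma sum_alias_term:
  assumes s: "s \<ge> 6"
  shows "(\<Sum>r = -int p..int p. alias_term s l N p t r) =
    of_nat (2 * p + 1) * (\<Sum>k = -int N..int N. of_real ((of_int k / real (Suc N)) ^ l * spl s s (of_int k / real (Suc N)))
       * cis (of_int k * t))"
proof -
  define L where "L = int (Suc N * (2 * p + 1)) + int s"
  have F: "x ^ l * spl s s x = 0" if "\<bar>x\<bar> \<ge> 1" for x
    using spl_s_eq_0_outside[OF that, of s] s by simp
  define g where "g y = (\<Sum>n = -L..L. of_real ((of_int n * (1 / (real (Suc N) * real (2 * p + 1)))) ^ l *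
      spl s s (of_int n * (1 / (real (Suc N) * real (2 * p + 1))))) *
       cis (of_int n * ((t + 2 * pi * y) / real (2 * p + 1))))" for y
  have L: "L \<ge> int (Suc N) * int (2 * p + 1)" by (simp only: L_def of_nat_mult)
  have "alias_term s l N p t r = g (of_int r)" for r
    unfolding alias_term_def Let_def L_def g_def by (simp only: of_nat_mult)
  then have "(\<Sum>r = -int p..int p. alias_term s l N p t r) = (\<Sum>j<2 * p + 1. g (real j - real p))"
    by (simp only: sum_centered_reindex[of g p])
  also have "\<dots> = of_nat (2 * p + 1) * (\<Sum>k = -int N..int N.
      of_real ((of_int k / real (Suc N)) ^ l * spl s s (of_int k / real (Suc N))) * cis (of_int k * t))"
    unfolding g_def by (rule sum_grid_refinement[where F = "\<lambda>x. x ^ l * spl s s x", OF F _ L]) simp_all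
  finally show ?thesis .
qed

text \<open>The finer mesh gives \<open>s - 1\<close> factors \<open>1 / R\<close>, and passing from
  sine to chord gives \<open>s\<close> factors \<open>R\<close>. The one that remains cancels when
  averaging over \<open>R\<close> aliases.\<close>

lemma norm_alias_term_le:
  assumes s: "s \<ge> 6" and l: "l \<le> 3" and ch: "chord p (t + 2 * pi * of_int r) > 0"
  shows "norm (alias_term s l N p t r) \<le> real (2 * p + 1) *
    ((1 / real (Suc N)) ^ (s - 1) * (2 * deriv_coeff l s) * (1 / chord p (t + 2 * pi * of_int r) ^ s))"
proof -
  define R where "R = real (2 * p + 1)"
  define M where "M = real (Suc N)"
  define x where "x = t + 2 * pi * of_int r"
  define S where "S = \<bar>sin (x / (2 * R))\<bar>"
  have R: "R > 0" by (simp add: R_def)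
  have e: "(t + 2 * pi * of_int r) / real (2 * p + 1) / 2 = x / (2 * R)"
    by (simp add: x_def R_def mult.commute)
  have nz: "sin (x / (2 * R)) \<noteq> 0" using ch by (auto simp: chord_def x_def R_def)
  have "norm (alias_term s l N p t r) \<le>
      (1 / real (Suc N * (2 * p + 1))) ^ (s - 1) * (2 * deriv_coeff l s) / (2 * S) ^ s"
    unfolding alias_term_def Let_def
    using norm_spl_exp_sum_le[OF s l, of "Suc N * (2 * p + 1)" "int (Suc N * (2 * p + 1)) + int s"
        "(t + 2 * pi * of_int r) / real (2 * p + 1)"] nz
    unfolding e S_def by (simp del: of_nat_Suc of_nat_mult of_nat_add mult_Suc)
  also have "real (Suc N * (2 * p + 1)) = M * R" by (simp only: of_nat_mult M_def R_def)
  also have "(1 / (M * R)) ^ (s - 1) * (2 * deriv_coeff l s) / (2 * S) ^ s =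
      R * ((1 / M) ^ (s - 1) * (2 * deriv_coeff l s) * (1 / (2 * R * S) ^ s))"
  proof -
    obtain n where n: "s = Suc n" using s by (cases s) auto
    show ?thesis using R by (simp add: n power_mult_distrib power_divide field_simps)
  qed
  also have "2 * R * S = chord p x" by (simp add: chord_def R_def S_def)
  finally show ?thesis by (simp add: R_def M_def x_def)
qed

text \<open>The left side does not involve the refinement, so the averaged alias bounds may be taken
  to the limit in \<open>p\<close>.\<close>

lemma norm_weighted_exp_sum_le:
  fixes t :: real
  assumes s: "s \<ge> 6" and l: "l \<le> 3" and t: "t \<noteq> 0" "\<bar>t\<bar> \<le> pi"
  shows "norm (\<Sum>k = -int N..int N. of_real ((of_int k / real (Suc N)) ^ l * spl s s (of_int k / real (Suc N)))
       * cis (of_int k * t)) \<le> (1 / real (Suc N)) ^ (s - 1) * (2 * deriv_coeff l s) * 2.02 / \<bar>t\<bar> ^ s"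
    (is "norm ?E \<le> _")
proof (rule alias_sum_limit[OF t s])
  have d: "deriv_coeff l s \<ge> 0" using s by (auto simp: deriv_coeff_def)
  then show W: "0 \<le> (1 / real (Suc N)) ^ (s - 1) * (2 * deriv_coeff l s)" by simp
  fix p
  define R where "R = real (2 * p + 1)"
  have R: "R > 0" by (simp add: R_def)
  have ch: "chord p (t + 2 * pi * of_int r) > 0" if r: "r \<in> {-int p..int p}" for r
  proof -
    define x where "x = t + 2 * pi * of_int r"
    have ar: "\<bar>2 * pi * of_int r\<bar> = 2 * pi * of_int \<bar>r\<bar>" by (simp add: abs_mult)
    have "real_of_int \<bar>r\<bar> \<le> real p" using r by auto
    then have b: "2 * pi * of_int \<bar>r\<bar> \<le> 2 * pi * real p" by (intro mult_left_mono) auto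
    have "\<bar>x\<bar> \<le> pi + 2 * pi * real p" using t ar b unfolding x_def by linarith
    then have xu: "\<bar>x\<bar> \<le> pi * real (2 * p + 1)" by (simp add: algebra_simps)
    have "x \<noteq> 0"
    proof (cases "r = 0")
      case False
      then have "of_int \<bar>r\<bar> \<ge> (1 :: real)" by simp
      then have "2 * pi * of_int \<bar>r\<bar> \<ge> 2 * pi * 1" by (intro mult_left_mono) auto
      then show ?thesis using t ar pi_gt_zero unfolding x_def by linarith
    qed (use t in \<open>simp add: x_def\<close>)
    then have "0 < 2 * \<bar>x\<bar> / pi" by simp
    then show ?thesis using chord_lower[OF xu] unfolding x_def by linarith
  qed
  have "R * norm ?E = norm (\<Sum>r = -int p..int p. alias_term s l N p t r)"
    unfolding sum_alias_term[OF s] by (simp add: norm_mult R_def del: of_nat_Suc of_nat_add of_nat_mult)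
  also have "\<dots> \<le> (\<Sum>r = -int p..int p. R * ((1 / real (Suc N)) ^ (s - 1) * (2 * deriv_coeff l s)
      * (1 / chord p (t + 2 * pi * of_int r) ^ s)))"
    unfolding R_def by (intro sum_norm_le norm_alias_term_le[OF s l] ch)
  also have "\<dots> = R * ((1 / real (Suc N)) ^ (s - 1) * (2 * deriv_coeff l s) *
      (\<Sum>r = -int p..int p. 1 / chord p (t + 2 * pi * of_int r) ^ s))"
    by (simp only: sum_distrib_left)
  finally show "norm ?E \<le> (1 / real (Suc N)) ^ (s - 1) * (2 * deriv_coeff l s) *
      (\<Sum>r = -int p..int p. 1 / chord p (t + 2 * pi * of_int r) ^ s)"
    using R by simp
qed

subsection \<open>The normalising sum\<close>

text \<open>By uniform continuity the spline exceeds its value at the left end of a cell by less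
  than \<open>e\<close>; over [-1, 1], of length 2, the antiderivative thus gains at most
  \<open>2 * e\<close> more than the Riemann sum.\<close>

lemma spl_riemann_sum_lower:
  assumes s: "even s" "s \<ge> 6" and e: "e > 0"
  shows "\<exists>K0. \<forall>K\<ge>K0. \<forall>L\<ge>int K. K \<ge> 1 \<longrightarrow>
    4 / (2 ^ s * fact (s - 1)) - 2 * e \<le> (1 / real K) * (\<Sum>n = -L..L. spl s s (of_int n * (1 / real K)))"
proof -
  have wd: "weak_deriv (spl s (Suc s)) (spl s s)" using s by (intro weak_deriv_spl) auto
  have "weak_deriv (spl s (Suc (s - 1))) (spl s (s - 1))" using s by (intro weak_deriv_spl) auto
  then have "continuous_on UNIV (spl s s)" using s by (simp add: weak_deriv_def)
  then have "continuous_on {-1..1} (spl s s)" by (rule continuous_on_subset) simp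
  then have "uniformly_continuous_on {-1..1} (spl s s)"
    by (rule compact_uniformly_continuous) simp
  then obtain d where d: "d > 0" "\<And>x y. x \<in> {-1..1} \<Longrightarrow> y \<in> {-1..1} \<Longrightarrow> dist y x < d \<Longrightarrow> dist (spl s s y) (spl s s x) < e"
    using e unfolding uniformly_continuous_on_def by metis
  obtain K0 :: nat where K0: "K0 > 1 / d" using reals_Archimedean2 by blast
  have "4 / (2 ^ s * fact (s - 1)) - 2 * e \<le> (1 / real K) * (\<Sum>n = -L..L. spl s s (of_int n * (1 / real K)))"
    if K: "K \<ge> K0" "K \<ge> 1" and L: "L \<ge> int K" for K L
  proof -
    define h where "h = 1 / real K"
    have h: "h > 0" "real K * h = 1" using K by (auto simp: h_def)
    have "1 / d < real K" using K0 K by linarith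
    then have hd: "h < d" using d(1) K by (simp add: h_def field_simps)
    have step: "spl s (Suc s) (of_int (n + 1) * h) - spl s (Suc s) (of_int n * h) \<le> h * spl s s (of_int n * h) + h * e"
      if n: "n \<in> {-int K..int K - 1}" for n
    proof -
      have lo: "- real K \<le> of_int n" and hi: "real_of_int (n + 1) \<le> real K" using n by auto
      have lo': "-1 \<le> of_int n * h" using mult_right_mono[OF lo, of h] h by simp
      have hi': "of_int (n + 1) * h \<le> 1" using mult_right_mono[OF hi, of h] h by simp
      have nh: "of_int (n + 1) * h = of_int n * h + h" by (simp add: algebra_simps)
      have "spl s (Suc s) (of_int n * h + h) - spl s (Suc s) (of_int n * h)
          \<le> (spl s s (of_int n * h) + e) * (of_int n * h + h - of_int n * h)"
      proof (rule weak_deriv_increment_le[OF wd])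
        fix x assume x: "of_int n * h < x" "x < of_int n * h + h"
        have "dist (spl s s x) (spl s s (of_int n * h)) < e"
          by (rule d(2)) (use x lo' hi' nh hd h in \<open>auto simp: dist_real_def\<close>)
        then show "spl s s x \<le> spl s s (of_int n * h) + e" by (simp add: dist_real_def abs_if split: if_splits)
      qed (use h in simp)
      then show ?thesis unfolding nh by (simp add: algebra_simps)
    qed
    have "spl s (Suc s) 1 - spl s (Suc s) (-1) =
        (\<Sum>n = -int K..int K - 1. spl s (Suc s) (of_int (n + 1) * h) - spl s (Suc s) (of_int n * h))"
      using sum_int_telescope[of "-int K" "int K - 1" "\<lambda>n. spl s (Suc s) (of_int n * h)"] K h by simp
    also have "\<dots> \<le> (\<Sum>n = -int K..int K - 1. h * spl s s (of_int n * h) + h * e)"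
      by (intro sum_mono step)
    also have "\<dots> = h * (\<Sum>n = -int K..int K - 1. spl s s (of_int n * h)) + 2 * (real K * h) * e"
      by (simp add: sum.distrib sum_distrib_left)
    also have "(\<Sum>n = -int K..int K - 1. spl s s (of_int n * h)) = (\<Sum>n = -L..L. spl s s (of_int n * h))"
    proof (rule sum.mono_neutral_left)
      show "\<forall>n\<in>{-L..L} - {-int K..int K - 1}. spl s s (of_int n * h) = 0"
      proof
        fix n assume "n \<in> {-L..L} - {-int K..int K - 1}"
        then have "\<bar>n\<bar> \<ge> int K" by auto
        then have "\<bar>real_of_int n\<bar> \<ge> real K" by linarith
        then have "\<bar>of_int n * h\<bar> \<ge> 1" using K by (simp add: h_def abs_mult field_simps)
        then show "spl s s (of_int n * h) = 0" using s by (intro spl_s_eq_0_outside) auto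
      qed
    qed (use L in auto)
    finally show ?thesis
      using spl_Suc_s_at_1[of s] s spl_eq_0_left[of "-1" s "Suc s"] h by (simp add: h_def)
  qed
  then show ?thesis by (intro exI[of _ K0] allI impI) blast
qed

text \<open>Jordan's inequality gives chords of at least \<open>4 * |r|\<close>, and
  \<open>1 / a^2 \<le> 2 / (a * (a + 1))\<close> feeds the tail bound with \<open>m = 0\<close>,
  whence the form \<open>{-0..0}\<close>.\<close>

lemma nonzero_aliases_at_0_le:
  assumes s: "s \<ge> 6"
  shows "(\<Sum>r\<in>{-int p..int p} - {-0..0}. 1 / chord p (2 * pi * of_int r) ^ s) \<le> 4 / 4 ^ s"
proof -
  have "1 / chord p (2 * pi * of_int r) ^ s \<le> 2 / 4 ^ s * (1 / of_int \<bar>r\<bar> - 1 / of_int (\<bar>r\<bar> + 1))"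
    if r: "0 < \<bar>r\<bar>" "\<bar>r\<bar> \<le> int p" for r :: int
  proof -
    define a where "a = real_of_int \<bar>r\<bar>"
    have "1 \<le> \<bar>r\<bar>" using r by simp
    then have a: "a \<ge> 1" "a \<le> real p" using r unfolding a_def by linarith+
    have x: "\<bar>2 * pi * of_int r\<bar> = 2 * pi * a" by (simp add: a_def abs_mult)
    have "pi * (2 * a) \<le> pi * real (2 * p + 1)" using a by (intro mult_left_mono) auto
    then have "\<bar>2 * pi * of_int r\<bar> \<le> pi * real (2 * p + 1)" unfolding x by (simp add: mult_ac)
    from chord_lower[OF this] have ch: "4 * a \<le> chord p (2 * pi * of_int r)" unfolding x by simp
    have "1 / chord p (2 * pi * of_int r) ^ s \<le> 1 / (4 * a) ^ s"
      using ch a by (intro divide_left_mono power_mono) auto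
    also have "\<dots> = 1 / 4 ^ s * (1 / a ^ s)" by (simp add: power_mult_distrib)
    finally have 1: "1 / chord p (2 * pi * of_int r) ^ s \<le> 1 / 4 ^ s * (1 / a ^ s)" .
    have "1 / a ^ s \<le> 1 / a ^ 2"
      using a s by (intro divide_left_mono power_increasing) auto
    also have "\<dots> \<le> 2 * (1 / a - 1 / (a + 1))"
    proof -
      have "1 / a ^ 2 = 2 / (2 * (a * a))" by (simp add: power2_eq_square)
      also have "\<dots> \<le> 2 / (a * (a + 1))"
      proof (rule frac_le)
        have "a * 1 \<le> a * a" using a by (intro mult_left_mono) auto
        then show "a * (a + 1) \<le> 2 * (a * a)" by (simp add: algebra_simps)
      qed (use a in auto)
      also have "\<dots> = 2 * (1 / a - 1 / (a + 1))" using a by (simp add: field_simps)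
      finally show ?thesis .
    qed
    finally have "1 / 4 ^ s * (1 / a ^ s) \<le> 1 / 4 ^ s * (2 * (1 / a - 1 / (a + 1)))"
      by (intro mult_left_mono) auto
    then show ?thesis using 1 by (simp add: a_def)
  qed
  from sum_symmetric_tail_le[of 0 "int p", OF this] show ?thesis by simp
qed

text \<open>The refinement identity at \<open>t = 0\<close>: alias 0 is a fine Riemann sum, close to
  the integral, and the other aliases are the error term.\<close>

lemma spl_sample_sum_lower:
  assumes s: "even s" "s \<ge> 6"
  shows "real (Suc N) * (4 / (2 ^ s * fact (s - 1))) - (1 / real (Suc N)) ^ (s - 1) * (2 * real s) * (4 / 4 ^ s)
    \<le> (\<Sum>k = -int N..int N. spl s s (of_int k / real (Suc N)))"
proof (rule field_le_epsilon)
  fix e :: real assume e: "e > 0"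
  define M where "M = real (Suc N)"
  define G where "G = (\<Sum>k = -int N..int N. spl s s (of_int k / real (Suc N)))"
  define I where "I = 4 / (2 ^ s * fact (s - 1) :: real)"
  define W where "W = (1 / real (Suc N)) ^ (s - 1) * (2 * real s)"
  have M: "M > 0" by (simp add: M_def)
  obtain K0 where K0: "\<And>K L. K \<ge> K0 \<Longrightarrow> L \<ge> int K \<Longrightarrow> K \<ge> 1 \<Longrightarrow>
     I - 2 * (e / (2 * M)) \<le> (1 / real K) * (\<Sum>n = -L..L. spl s s (of_int n * (1 / real K)))"
    using spl_riemann_sum_lower[OF s, of "e / (2 * M)"] e M unfolding I_def by auto
  \<comment> \<open>This makes \<open>K = Suc N * (2 * p + 1)\<close> at least \<open>K0\<close>.
    The tolerance \<open>e / (2 * M)\<close> becomes \<open>e\<close> after doubling and multiplying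
    by \<open>M\<close>.\<close>
  define p where "p = K0"
  define R where "R = real (2 * p + 1)"
  define K where "K = Suc N * (2 * p + 1)"
  define L where "L = int K + int s"
  define S0 where "S0 = (\<Sum>n = -L..L. spl s s (of_int n * (1 / real K)))"
  have R: "R > 0" by (simp add: R_def)
  have KR: "real K = M * R" unfolding K_def M_def R_def by (rule of_nat_mult)
  have "K \<ge> K0" "K \<ge> 1" by (auto simp: K_def p_def)
  then have "I - 2 * (e / (2 * M)) \<le> (1 / real K) * S0"
    unfolding S0_def by (intro K0) (auto simp: L_def)
  then have S0: "R * (M * I - e) \<le> S0"
  proof -
    have "R * (M * I - e) = M * R * (I - 2 * (e / (2 * M)))" using M by (simp add: field_simps)
    also have "\<dots> \<le> M * R * ((1 / real K) * S0)"
      using M R \<open>I - 2 * (e / (2 * M)) \<le> (1 / real K) * S0\<close> by (intro mult_left_mono) auto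
    also have "\<dots> = S0" using M R unfolding KR by simp
    finally show ?thesis .
  qed
  have a0: "alias_term s 0 N p 0 0 = of_real S0"
    unfolding alias_term_def Let_def S0_def L_def K_def by simp
  have "of_real (R * G) = (\<Sum>r = -int p..int p. alias_term s 0 N p 0 r)"
    unfolding sum_alias_term[OF s(2)] G_def R_def by (simp add: of_real_sum)
  also have "\<dots> = (\<Sum>r\<in>{-int p..int p} - {0..0}. alias_term s 0 N p 0 r) + (\<Sum>r = 0..0. alias_term s 0 N p 0 r)"
    by (rule sum.subset_diff) auto
  finally have "of_real (S0 - R * G) = - (\<Sum>r\<in>{-int p..int p} - {0..0}. alias_term s 0 N p 0 r)"
    by (simp add: a0)
  then have "\<bar>S0 - R * G\<bar> = norm (\<Sum>r\<in>{-int p..int p} - {0..0}. alias_term s 0 N p 0 r)"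
    by (metis norm_minus_cancel norm_of_real)
  also have "\<dots> \<le> (\<Sum>r\<in>{-int p..int p} - {0..0}. R * (W * (1 / chord p (2 * pi * of_int r) ^ s)))"
  proof (rule sum_norm_le)
    fix r assume r: "r \<in> {-int p..int p} - {0..0}"
    have x: "\<bar>2 * pi * of_int r\<bar> = pi * (2 * real_of_int \<bar>r\<bar>)" by (simp add: abs_mult)
    have "real_of_int \<bar>r\<bar> \<le> real p" using r by auto
    then have "pi * (2 * real_of_int \<bar>r\<bar>) \<le> pi * real (2 * p + 1)" by (intro mult_left_mono) auto
    then have "2 * \<bar>2 * pi * of_int r\<bar> / pi \<le> chord p (2 * pi * of_int r)"
      unfolding x[symmetric] by (rule chord_lower)
    moreover have "0 < 2 * \<bar>2 * pi * of_int r\<bar> / pi" using r by simp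
    ultimately have "chord p (0 + 2 * pi * of_int r) > 0" by simp
    from norm_alias_term_le[OF s(2) _ this, of 0 N]
    show "norm (alias_term s 0 N p 0 r) \<le> R * (W * (1 / chord p (2 * pi * of_int r) ^ s))"
      by (simp add: R_def W_def deriv_coeff_def del: of_nat_Suc of_nat_add of_nat_mult)
  qed
  also have "\<dots> = R * (W * (\<Sum>r\<in>{-int p..int p} - {-0..0}. 1 / chord p (2 * pi * of_int r) ^ s))"
    by (simp only: sum_distrib_left minus_zero)
  also have "\<dots> \<le> R * (W * (4 / 4 ^ s))"
    using R nonzero_aliases_at_0_le[OF s(2), of p] by (intro mult_left_mono) (auto simp: W_def)
  finally have "R * (M * I - e) \<le> R * G + R * (W * (4 / 4 ^ s))" using S0 by linarith
  then have "R * (M * I - e) \<le> R * (G + W * (4 / 4 ^ s))" by (simp only: distrib_left)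
  then have "M * I - e \<le> G + W * (4 / 4 ^ s)" using R by simp
  then show "real (Suc N) * (4 / (2 ^ s * fact (s - 1))) - (1 / real (Suc N)) ^ (s - 1) * (2 * real s) * (4 / 4 ^ s)
    \<le> (\<Sum>k = -int N..int N. spl s s (of_int k / real (Suc N))) + e"
    unfolding M_def I_def W_def G_def by linarith
qed

lemma gtilde_sample:
  assumes "even s" "s \<ge> 2" "k \<in> {-int N..int N}"
  shows "gtilde s (real_of_int k / (2 * (real N + 1))) = spl s s (of_int k / real (Suc N))"
proof -
  have "2 * (real_of_int k / (2 * (real N + 1))) = of_int k / real (Suc N)" by (simp add: field_simps)
  moreover have "\<bar>real_of_int k\<bar> \<le> real (Suc N)" using assms(3) by auto
  then have "of_int k / real (Suc N) \<in> {-1..1}" by (auto simp: field_simps abs_le_iff)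
  ultimately show ?thesis unfolding gtilde_def using perfect_bspline_eq_spl[OF assms(1,2)] by simp
qed

text \<open>With \<open>M = N + 1\<close> the relative error is
  \<open>2 * fact s / (2 * M) ^ s\<close>. From \<open>fact s \<le> s ^ s\<close> and
  \<open>M \<ge> 2 * s\<close> it is at most \<open>2 / 4 ^ 6\<close>.\<close>

lemma gnorm1_lower:
  assumes s: "even s" "s \<ge> 6" and N: "N \<ge> 2 * s"
  shows "0.999 * (real (Suc N) * (4 / (2 ^ s * fact (s - 1)))) \<le> gnorm1 s N"
proof -
  define M where "M = real (Suc N)"
  have M: "M \<ge> 2 * real s" "M > 0" using N by (auto simp: M_def)
  have "gnorm1 s N = (\<Sum>k = -int N..int N. spl s s (of_int k / real (Suc N)))"
    unfolding gnorm1_def using s by (intro sum.cong gtilde_sample) auto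
  then have 1: "M * (4 / (2 ^ s * fact (s - 1))) - (1 / M) ^ (s - 1) * (2 * real s) * (4 / 4 ^ s) \<le> gnorm1 s N"
    using spl_sample_sum_lower[OF s, of N] unfolding M_def by (simp del: of_nat_Suc)
  have "(1 / M) ^ (s - 1) * (2 * real s) * (4 / 4 ^ s) =
      (M * (4 / (2 ^ s * fact (s - 1)))) * (2 * fact s / (2 * M) ^ s)"
  proof -
    obtain n where n: "s = Suc n" using s by (cases s) auto
    have f4: "(4::real) ^ s = 2 ^ s * 2 ^ s" by (simp flip: power_mult_distrib)
    show ?thesis
      unfolding f4 using M(2) by (simp add: n power_mult_distrib field_simps)
  qed
  also have "\<dots> \<le> (M * (4 / (2 ^ s * fact (s - 1)))) * 0.001"
  proof (rule mult_left_mono)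
    have "2 * fact s / (2 * M) ^ s \<le> 2 * real s ^ s / (2 * (2 * real s)) ^ s"
    proof (rule frac_le)
      show "2 * fact s \<le> 2 * real s ^ s" using fact_le_power[of s, where 'a = real] by simp
      show "(2 * (2 * real s)) ^ s \<le> (2 * M) ^ s" using M by (intro power_mono) auto
    qed (use s in auto)
    also have "\<dots> = 2 / 4 ^ s" using s by (simp add: power_mult_distrib)
    also have "\<dots> \<le> 2 / 4 ^ 6" using s by (intro divide_left_mono power_increasing) auto
    finally show "2 * fact s / (2 * M) ^ s \<le> 0.001" by simp
  qed (use M in auto)
  finally have "(1 / M) ^ (s - 1) * (2 * real s) * (4 / 4 ^ s) \<le> M * (4 / (2 ^ s * fact (s - 1))) * 0.001" .
  moreover have "0.999 * a \<le> c" if "a - b \<le> c" "b \<le> a * 0.001" for a b c :: real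
    using that by simp
  ultimately show ?thesis using 1 unfolding M_def by blast
qed

section \<open>Derivatives of the kernel and the final estimate\<close>

lemma nth_vderiv_sigma_tilde:
  "nth_vderiv l (sigma_tilde s N) = (\<lambda>t. complex_of_real (inverse (gnorm1 s N)) *
     (\<Sum>k = -int N..int N. complex_of_real (gtilde s (real_of_int k / (2 * (real N + 1))))
        * ((\<i> * of_int k) ^ l * exp (\<i> * of_int k * complex_of_real t))))"
proof (induction l)
  case 0
  then show ?case by (simp add: nth_vderiv_def sigma_tilde_def[abs_def])
next
  case (Suc l)
  have d: "((\<lambda>t. exp (\<i> * of_int k * complex_of_real t)) has_vector_derivative
      \<i> * of_int k * exp (\<i> * of_int k * complex_of_real t)) (at t)" for k :: int and t
  proof -
    have "((\<lambda>z. exp (\<i> * of_int k * z)) has_field_derivative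
        \<i> * of_int k * exp (\<i> * of_int k * complex_of_real t)) (at (complex_of_real t))"
      by (auto intro!: derivative_eq_intros)
    from has_vector_derivative_real_field[OF this] show ?thesis .
  qed
  have "((\<lambda>t. complex_of_real (inverse (gnorm1 s N)) *
     (\<Sum>k = -int N..int N. complex_of_real (gtilde s (real_of_int k / (2 * (real N + 1))))
        * ((\<i> * of_int k) ^ l * exp (\<i> * of_int k * complex_of_real t)))) has_vector_derivative
     complex_of_real (inverse (gnorm1 s N)) *
     (\<Sum>k = -int N..int N. complex_of_real (gtilde s (real_of_int k / (2 * (real N + 1))))
        * ((\<i> * of_int k) ^ l * (\<i> * of_int k * exp (\<i> * of_int k * complex_of_real t))))) (at t)" for t
    by (intro has_vector_derivative_mult_right has_vector_derivative_sum d)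
  from vector_derivative_at[OF this] show ?case
    using Suc by (simp add: nth_vderiv_def mult_ac)
qed

lemma cconst_deriv_coeff: "cconst l s = 1.02 * fact (s - 1) * 2 ^ s * deriv_coeff l s"
  by (simp add: cconst_def deriv_coeff_def)

theorem theoremA3:
  fixes s N l :: nat and t :: real
  assumes "even s" and "s \<ge> 6" and "N \<ge> 2 * s"
    and "t \<in> {-pi..pi}" and "t \<noteq> 0" and "l \<le> 3"
  shows "norm (nth_vderiv l (sigma_tilde s N) t)
           \<le> cconst l s / ((real N + 1) ^ (s - l) * \<bar>t\<bar> ^ s)"
proof -
  define M where "M = real (Suc N)"
  have M: "M > 0" by (simp add: M_def)
  define D where "D = deriv_coeff l s"
  have D: "D \<ge> 0" using assms(2) by (auto simp: D_def deriv_coeff_def)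
  define E where "E = (\<Sum>k = -int N..int N. of_real ((of_int k / M) ^ l * spl s s (of_int k / M)) * cis (of_int k * t))"
  define I where "I = 4 / (2 ^ s * fact (s - 1) :: real)"
  have I: "I > 0" by (simp add: I_def)
  have g: "0.999 * (M * I) \<le> gnorm1 s N" unfolding M_def I_def by (rule gnorm1_lower[OF assms(1-3)])
  have MI: "0 < 0.999 * (M * I)" using M I by simp
  have t: "t \<noteq> 0" "\<bar>t\<bar> \<le> pi" using assms by auto
  \<comment> \<open>Writing \<open>k = M * (k / M)\<close> turns the factors brought down by
    differentiation into moments on the grid of mesh \<open>1 / M\<close>.\<close>
  have "(\<Sum>k = -int N..int N. complex_of_real (gtilde s (real_of_int k / (2 * (real N + 1))))
        * ((\<i> * of_int k) ^ l * exp (\<i> * of_int k * complex_of_real t))) = \<i> ^ l * of_real (M ^ l) * E"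
    unfolding E_def sum_distrib_left
  proof (rule sum.cong[OF refl])
    fix k assume k: "k \<in> {-int N..int N}"
    have "gtilde s (real_of_int k / (2 * (real N + 1))) = spl s s (of_int k / M)"
      unfolding M_def using assms k by (intro gtilde_sample) auto
    moreover have "exp (\<i> * of_int k * complex_of_real t) = cis (of_int k * t)"
      by (simp add: cis_conv_exp mult_ac)
    moreover have "(\<i> * of_int k) ^ l = \<i> ^ l * of_real (M ^ l) * of_real ((of_int k / M) ^ l)"
      using M by (simp add: power_mult_distrib power_divide)
    ultimately show "complex_of_real (gtilde s (real_of_int k / (2 * (real N + 1))))
        * ((\<i> * of_int k) ^ l * exp (\<i> * of_int k * complex_of_real t)) =
        \<i> ^ l * of_real (M ^ l) * (of_real ((of_int k / M) ^ l * spl s s (of_int k / M)) * cis (of_int k * t))"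
      by (simp add: mult_ac)
  qed
  then have "norm (nth_vderiv l (sigma_tilde s N) t) = \<bar>inverse (gnorm1 s N)\<bar> * (M ^ l * norm E)"
    unfolding nth_vderiv_sigma_tilde norm_mult norm_of_real using M by (simp add: norm_mult norm_power)
  also have "\<dots> \<le> inverse (0.999 * (M * I)) * (M ^ l * ((1 / M) ^ (s - 1) * (2 * D) * 2.02 / \<bar>t\<bar> ^ s))"
  proof (intro mult_mono)
    have "\<bar>inverse (gnorm1 s N)\<bar> = inverse (gnorm1 s N)"
      using order.strict_trans2[OF MI g] by simp
    then show "\<bar>inverse (gnorm1 s N)\<bar> \<le> inverse (0.999 * (M * I))"
      using le_imp_inverse_le[OF g MI] by simp
    show "norm E \<le> (1 / M) ^ (s - 1) * (2 * D) * 2.02 / \<bar>t\<bar> ^ s"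
      unfolding E_def M_def D_def by (rule norm_weighted_exp_sum_le[OF assms(2,6) t])
  qed (use M I in auto)
  also have "\<dots> = (4.04 / (4 * 0.999)) * (fact (s - 1) * 2 ^ s * D / (M ^ (s - l) * \<bar>t\<bar> ^ s))"
  proof -
    obtain n where n: "s = Suc n" using assms(2) by (cases s) auto
    have "M ^ s = M ^ (s - l) * M ^ l" using assms by (simp flip: power_add)
    then have "inverse M * (M ^ l * (1 / M) ^ (s - 1)) = 1 / M ^ (s - l)"
      using M by (simp add: n power_divide field_simps)
    moreover have "inverse (0.999 * (M * I)) * (M ^ l * ((1 / M) ^ (s - 1) * (2 * D) * 2.02 / \<bar>t\<bar> ^ s)) =
       inverse M * (M ^ l * (1 / M) ^ (s - 1)) * (inverse (0.999 * I) * (2 * D) * 2.02 / \<bar>t\<bar> ^ s)"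
      by (simp only: divide_inverse inverse_mult_distrib mult_ac)
    ultimately show ?thesis by (simp add: I_def field_simps)
  qed
  \<comment> \<open>\<open>4.04 = 2 * 2.02\<close> stems from the aliases, 4 from the integral and
    0.999 from the normalising sum; the quotient is below 1.012.\<close>
  also have "\<dots> \<le> 1.02 * (fact (s - 1) * 2 ^ s * D / (M ^ (s - l) * \<bar>t\<bar> ^ s))"
    using D M by (intro mult_right_mono) auto
  also have "\<dots> = cconst l s / ((real N + 1) ^ (s - l) * \<bar>t\<bar> ^ s)"
    by (simp add: cconst_deriv_coeff D_def M_def add.commute)
  finally show ?thesis .
qed

end
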